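(* Assume the standing setting (S) of the context, that $B$ is Lipschitz on $\mathsf H_1$, and that the spectral projections $P_R=E([-R,R])$ of $A$ (as a self-adjoint operator in $\mathsf H_0$, with spectral measure $E$) restrict to bounded operators on $\mathsf H_1$ with $\sup_{R>0}\|P_R\|_{\mathcal B(\mathsf H_1)}<\infty$. Let $a_1,\dots,a_s,b_1,\dots,b_s\in\mathbb R$ with $\sum_ja_j=\sum_jb_j=1$, and for $R>0$ define $$\widetilde\Phi_{h}=\Phi^B(b_sh)\circ\Phi^A(a_sh)P_R\circ\cdots\circ\Phi^B(b_1h)\circ\Phi^A(a_1h)P_R.$$ Let $u_0\in\mathsf H_1$ and $0<T<T^*(u_0)$. Then there exist $C>0$ and $n_0\in\mathbb N$ such that for all $n\ge n_0$, with $h_n=T/n$, and all $R\ge h_n^{-2}$, $$\max_{0\le k\le n}\|\Phi(kh_n)u_0-\widetilde\Phi_{h_n}^k u_0\|_{\mathsf H_0}\le C\,h_n.$$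
   Context: Standing setting (S). $\mathsf H_0,\mathsf H_1$ are complex Hilbert spaces with $\mathsf H_1$ continuously embedded in $\mathsf H_0$. $A$ is a self-adjoint operator in $\mathsf H_1$ which admits a self-adjoint extension in $\mathsf H_0$ (still denoted $A$) whose domain contains $\mathsf H_1$; $\Phi^A(t)=e^{-itA}$ denotes the corresponding unitary groups on $\mathsf H_1$ and $\mathsf H_0$ (they agree on $\mathsf H_1$). $B:\mathsf H_1\to\mathsf H_1$ is locally Lipschitz with $B(0)=0$, and satisfies condition (D): there is a map $B':\mathsf H_1\to\mathcal B(\mathsf H_0)$ such that for all $R,\varepsilon>0$ there exist $C,\delta>0$ with $\|B'(u)\|_{\mathcal B(\mathsf H_0)}\le C$ and $\|B(u+w)-B(u)-B'(u)w\|_{\mathsf H_0}\le\varepsilon\|w\|_{\mathsf H_0}$ for all $u,w\in\mathsf H_1$ with $\|u\|_{\mathsf H_1}\le R$, $\|w\|_{\mathsf H_1}<\delta$. For $u_0\in\mathsf H_1$, $\Phi(t)u_0=u(t)$ is the maximal solution $u\in C([0,T^*(u_0)),\mathsf H_1)$ of $u(t)=\Phi^A(t)u_0-i\int_0^t\Phi^A(t-t')B(u(t'))dt'$, and it is assumed that $u\in W^{1,\infty}([0,T],\mathsf H_0)$ for $T<T^*(u_0)$. $\Phi^B(t)$ denotes the flow on $\mathsf H_1$ of $w_t+iB(w)=0$, $w(0)=w_0$. $\widetilde\Phi_{h}^k$ is the $k$-fold composition. *)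

theory Defs
  imports "HOL-Analysis.Analysis"
begin

(* Complex Hilbert spaces are modelled as real Hilbert spaces ('a::{real_inner,complete_space})
   together with a complex structure J ("multiplication by i"). *)

definition cstruct :: "('a::real_inner \<Rightarrow> 'a) \<Rightarrow> bool" where
  "cstruct J \<longleftrightarrow> linear J \<and> (\<forall>x. J (J x) = - x) \<and> (\<forall>x y. J x \<bullet> J y = x \<bullet> y)"

definition selfadjoint_op :: "('a::real_inner \<Rightarrow> 'a) \<Rightarrow> 'a set \<Rightarrow> ('a \<Rightarrow> 'a) \<Rightarrow> bool" where
  "selfadjoint_op J D A \<longleftrightarrow>
     subspace D \<and> (\<forall>x\<in>D. J x \<in> D) \<and> closure D = UNIV \<and>
     (\<forall>x\<in>D. \<forall>y\<in>D. A (x + y) = A x + A y) \<and>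
     (\<forall>x\<in>D. \<forall>c. A (c *\<^sub>R x) = c *\<^sub>R A x) \<and>
     (\<forall>x\<in>D. A (J x) = J (A x)) \<and>
     (\<forall>x\<in>D. \<forall>y\<in>D. A x \<bullet> y = x \<bullet> A y) \<and>
     {y. \<exists>z. \<forall>x\<in>D. A x \<bullet> y = x \<bullet> z} \<subseteq> D"

definition unitary_group_of :: "('a::real_normed_vector \<Rightarrow> 'a) \<Rightarrow> 'a set \<Rightarrow> ('a \<Rightarrow> 'a) \<Rightarrow> (real \<Rightarrow> 'a \<Rightarrow> 'a) \<Rightarrow> bool" where
  "unitary_group_of J D A U \<longleftrightarrow>
     (\<forall>t. bounded_linear (U t) \<and> (\<forall>x. U t (J x) = J (U t x)) \<and> (\<forall>x. norm (U t x) = norm x) \<and> surj (U t)) \<and>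
     (\<forall>x. U 0 x = x) \<and> (\<forall>s t x. U (s + t) x = U s (U t x)) \<and>
     (\<forall>x. continuous_on UNIV (\<lambda>t. U t x)) \<and>
     (\<forall>x. x \<in> D \<longleftrightarrow> (\<exists>v. ((\<lambda>t. U t x) has_vector_derivative v) (at 0))) \<and>
     (\<forall>x\<in>D. ((\<lambda>t. U t x) has_vector_derivative - J (A x)) (at 0))"

definition pvm :: "('a::real_inner \<Rightarrow> 'a) \<Rightarrow> (real set \<Rightarrow> 'a \<Rightarrow> 'a) \<Rightarrow> bool" where
  "pvm J E \<longleftrightarrow>
     (\<forall>S\<in>sets borel. bounded_linear (E S) \<and> (\<forall>x. E S (E S x) = E S x) \<and>
        (\<forall>x y. E S x \<bullet> y = x \<bullet> E S y) \<and> (\<forall>x. E S (J x) = J (E S x))) \<and>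
     (\<forall>x. E UNIV x = x) \<and>
     (\<forall>S\<in>sets borel. \<forall>T\<in>sets borel. \<forall>x. E (S \<inter> T) x = E S (E T x)) \<and>
     (\<forall>F. range F \<subseteq> sets borel \<longrightarrow> disjoint_family F \<longrightarrow>
        (\<forall>x. (\<lambda>n. \<Sum>i<n. E (F i) x) \<longlonglongrightarrow> E (\<Union>i. F i) x))"

definition spec_meas :: "(real set \<Rightarrow> 'a::real_inner \<Rightarrow> 'a) \<Rightarrow> 'a \<Rightarrow> real measure" where
  "spec_meas E x = measure_of UNIV (sets borel) (\<lambda>S. ennreal (E S x \<bullet> x))"

definition spectral_measure_of :: "('a::real_inner \<Rightarrow> 'a) \<Rightarrow> 'a set \<Rightarrow> ('a \<Rightarrow> 'a) \<Rightarrow> (real set \<Rightarrow> 'a \<Rightarrow> 'a) \<Rightarrow> bool" where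
  "spectral_measure_of J D A E \<longleftrightarrow> pvm J E \<and>
     (\<forall>x. x \<in> D \<longleftrightarrow> integrable (spec_meas E x) (\<lambda>l. l\<^sup>2)) \<and>
     (\<forall>x\<in>D. A x \<bullet> x = integral\<^sup>L (spec_meas E x) (\<lambda>l. l))"

definition mild_sol :: "('b::{real_normed_vector,complete_space} \<Rightarrow> 'b) \<Rightarrow> (real \<Rightarrow> 'b \<Rightarrow> 'b) \<Rightarrow> ('b \<Rightarrow> 'b) \<Rightarrow> 'b \<Rightarrow> real \<Rightarrow> (real \<Rightarrow> 'b) \<Rightarrow> bool" where
  "mild_sol J U B u0 T u \<longleftrightarrow> continuous_on {0..<T} u \<and>
     (\<forall>t\<in>{0..<T}. u t = U t u0 - J (integral {0..t} (\<lambda>s. U (t - s) (B (u s)))))"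

definition Tstar :: "('b::{real_normed_vector,complete_space} \<Rightarrow> 'b) \<Rightarrow> (real \<Rightarrow> 'b \<Rightarrow> 'b) \<Rightarrow> ('b \<Rightarrow> 'b) \<Rightarrow> 'b \<Rightarrow> ereal" where
  "Tstar J U B u0 = (SUP T\<in>{T. T > 0 \<and> (\<exists>u. mild_sol J U B u0 T u)}. ereal T)"

definition Phi :: "('b::{real_normed_vector,complete_space} \<Rightarrow> 'b) \<Rightarrow> (real \<Rightarrow> 'b \<Rightarrow> 'b) \<Rightarrow> ('b \<Rightarrow> 'b) \<Rightarrow> real \<Rightarrow> 'b \<Rightarrow> 'b" where
  "Phi J U B t u0 = (THE x. \<exists>T u. t < T \<and> mild_sol J U B u0 T u \<and> u t = x)"

definition PhiB :: "('b::real_normed_vector \<Rightarrow> 'b) \<Rightarrow> ('b \<Rightarrow> 'b) \<Rightarrow> real \<Rightarrow> 'b \<Rightarrow> 'b" where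
  "PhiB J B t w0 = (THE x. \<exists>w. w 0 = w0 \<and>
      (\<forall>s. (w has_vector_derivative - J (B (w s))) (at s)) \<and> w t = x)"

fun compose_steps :: "(nat \<Rightarrow> 'b \<Rightarrow> 'b) \<Rightarrow> nat \<Rightarrow> 'b \<Rightarrow> 'b" where
  "compose_steps step 0 = id"
| "compose_steps step (Suc j) = step (Suc j) \<circ> compose_steps step j"

definition split_step :: "('b::real_normed_vector \<Rightarrow> 'b) \<Rightarrow> (real \<Rightarrow> 'b \<Rightarrow> 'b) \<Rightarrow> ('b \<Rightarrow> 'b) \<Rightarrow> ('b \<Rightarrow> 'b)
     \<Rightarrow> nat \<Rightarrow> (nat \<Rightarrow> real) \<Rightarrow> (nat \<Rightarrow> real) \<Rightarrow> real \<Rightarrow> 'b \<Rightarrow> 'b" where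
  "split_step J U B P s a b h =
     compose_steps (\<lambda>j v. PhiB J B (b j * h) (U (a j * h) (P v))) s"

end

theory Submission
  imports Defs
begin

text \<open>
  Since \<open>range \<iota> \<subseteq> D0\<close>, the uniform boundedness principle gives
  \<open>norm (\<iota> (U1 t v - v)) \<le> C * norm v * \<bar>t\<bar>\<close> and
  \<open>norm (\<iota> (v - P1 R v)) \<le> C * norm v / R\<close>.  Condition (D) makes \<open>B\<close> Lipschitz for the weak norm
  \<open>norm (\<iota> v)\<close> on balls of the strong norm.  Hence, on such balls, the exact flow and one step of the
  scheme both equal \<open>U1 h v - h J1 (B v) + O(h\<^sup>2)\<close> in the weak norm (for the scheme because
  \<open>1 / R \<le> h\<^sup>2\<close>).  The scheme stays in a ball of the strong norm because \<open>P1 R\<close> is a projection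
  commuting with \<open>U1 t\<close>, and a discrete Gronwall argument sums the local errors.
\<close>

section \<open>Integration in complete normed spaces\<close>

text \<open>Local errors are of second order only in the weak norm, with constants depending on the
  strong norm of the argument, and \<open>B\<close> is weakly Lipschitz only on strong balls. So a
  strong bound on all iterates, uniform in \<open>k\<close>, \<open>n\<close> and \<open>R\<close>,
  must come before any weak estimate can be iterated. The coefficients enter the first-order
  expansion only through their sums: moving a factor \<open>U1\<close> past \<open>J1 (B v)\<close>
  costs O(h) in the weak norm, and that term already carries a factor h. Each step applies the
  cut-off \<open>s\<close> times; a loss of order 1 / R in each of n = T / h steps adds up to O(h)
  precisely when 1 / R = O(h^2). The spectral measure is known only through moments:
  \<open>D0\<close> by the second, \<open>A0 x \<bullet> x\<close> by the first. Hence the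
  commutation of \<open>E S\<close> with \<open>A0\<close>, and then with \<open>U0\<close> on
  \<open>D0\<close>, has to be derived; it passes to \<open>P1 R\<close> and \<open>U1\<close>
  because \<open>\<iota>\<close> is injective. The coefficients may be negative, so the flow of
  \<open>B\<close> is studied on the whole time axis.\<close>

text \<open>
  The sort \<open>{real_normed_vector, complete_space}\<close> is not a subsort of \<open>banach\<close>, so the library's
  integration theorems do not apply to it directly.  Constant functions embed such a space
  isometrically into a space of bounded continuous functions, which can be made an instance of
  \<open>banach\<close>, and evaluation at a point projects back.
\<close>

instance bcontfun :: (metric_space, "{real_normed_vector,complete_space}") banach ..

lemma bounded_linear_const_bcontfun:
  "bounded_linear (const_bcontfun :: 'a::real_normed_vector \<Rightarrow> (real \<Rightarrow>\<^sub>C 'a))"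
  by (rule bounded_linear_intro[where K = 1])
     (auto intro!: bcontfun_eqI norm_bound simp: const_bcontfun.rep_eq plus_bcontfun.rep_eq scaleR_bcontfun.rep_eq)

lemma bounded_linear_eval_bcontfun:
  "bounded_linear (\<lambda>f :: real \<Rightarrow>\<^sub>C 'a::real_normed_vector. apply_bcontfun f 0)"
  by (rule bounded_linear_intro[where K = 1])
     (auto simp: norm_bounded plus_bcontfun.rep_eq scaleR_bcontfun.rep_eq)

lemma integral_has_vector_derivative_complete:
  fixes f :: "real \<Rightarrow> 'a::{real_normed_vector,complete_space}"
  assumes "continuous_on {a..b} f"
  shows "f integrable_on {a..b}"
    and "x \<in> {a..b} \<Longrightarrow> ((\<lambda>t. integral {a..t} f) has_vector_derivative f x) (at x within {a..b})"
proof -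
  let ?e = "const_bcontfun :: 'a \<Rightarrow> (real \<Rightarrow>\<^sub>C 'a)"
  let ?p = "\<lambda>g :: real \<Rightarrow>\<^sub>C 'a. apply_bcontfun g 0"
  have cont: "continuous_on {a..b} (\<lambda>t. ?e (f t))"
    by (rule bounded_linear.continuous_on[OF bounded_linear_const_bcontfun assms])
  have pe: "?p \<circ> (\<lambda>t. ?e (f t)) = f"
    by (simp add: fun_eq_iff const_bcontfun.rep_eq)
  have int: "(\<lambda>t. ?e (f t)) integrable_on {a..t}" if "t \<in> {a..b}" for t
    using that by (auto intro!: integrable_continuous_real continuous_on_subset[OF cont])
  show "f integrable_on {a..b}"
    using integrable_linear[OF integrable_continuous_real[OF cont] bounded_linear_eval_bcontfun]
    by (simp only: pe)
  assume x: "x \<in> {a..b}"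
  have "((\<lambda>t. ?p (integral {a..t} (\<lambda>t. ?e (f t)))) has_vector_derivative ?p (?e (f x)))
          (at x within {a..b})"
    by (rule bounded_linear.has_vector_derivative[OF bounded_linear_eval_bcontfun
          integral_has_vector_derivative[OF cont x]])
  then have deriv: "((\<lambda>t. ?p (integral {a..t} (\<lambda>t. ?e (f t)))) has_vector_derivative f x)
          (at x within {a..b})"
    by (simp only: const_bcontfun.rep_eq)
  have eq: "integral {a..t} f = ?p (integral {a..t} (\<lambda>t. ?e (f t)))" if "t \<in> {a..b}" for t
    using integral_linear[OF int[OF that] bounded_linear_eval_bcontfun] by (simp only: pe)
  show "((\<lambda>t. integral {a..t} f) has_vector_derivative f x) (at x within {a..b})"
    by (rule has_vector_derivative_transform[OF x eq deriv])
qed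

text \<open>Stated on the whole line because negative coefficients run \<open>PhiB\<close> backwards
  in time.\<close>

lemma antiderivative_exists_banach:
  fixes f :: "real \<Rightarrow> 'a::banach"
  assumes f: "continuous_on UNIV f"
  shows "\<exists>F. F 0 = 0 \<and> (\<forall>t. (F has_vector_derivative f t) (at t))"
proof -
  \<comment> \<open>An integral over reversed endpoints is 0, so this difference is the signed
    integral from 0 to \<open>t\<close>.\<close>
  let ?F = "\<lambda>t. integral {0..t} f - integral {t..0} f"
  have int: "f integrable_on {a..b}" for a b
    by (intro integrable_continuous_real continuous_on_subset[OF f]) simp
  have "(?F has_vector_derivative f t) (at t)" for t :: real
  proof -
    define N where "N = \<bar>t\<bar> + 1"
    have t: "t \<in> {-N..N}"
      by (auto simp: N_def)
    \<comment> \<open>On \<open>{-N..N}\<close> the signed integral differs by a constant from an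
      integral with fixed left endpoint, which makes it differentiable across 0 as well.\<close>
    have eq: "?F x = integral {-N..x} f - integral {-N..0} f" if "x \<in> {-N..N}" for x
    proof (cases "0 \<le> x")
      case True
      have "integral {-N..0} f + integral {0..x} f = integral {-N..x} f"
        using True by (intro Henstock_Kurzweil_Integration.integral_combine int) (simp_all add: N_def)
      moreover have "integral {x..0} f = 0"
        using True by (cases "x = 0") simp_all
      ultimately show ?thesis by (simp add: algebra_simps)
    next
      case False
      have "integral {-N..x} f + integral {x..0} f = integral {-N..0} f"
        using False that by (intro Henstock_Kurzweil_Integration.integral_combine int) simp_all
      moreover have "integral {0..x} f = 0"
        using False by simp
      ultimately show ?thesis by (simp add: algebra_simps)
    qed
    have "((\<lambda>x. integral {-N..x} f) has_vector_derivative f t) (at t within {-N..N})"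
      by (rule integral_has_vector_derivative[OF continuous_on_subset[OF f] t]) simp
    from has_vector_derivative_diff[OF this has_vector_derivative_const[of "integral {-N..0} f"]]
    have "((\<lambda>x. integral {-N..x} f - integral {-N..0} f) has_vector_derivative f t)
        (at t within {-N..N})"
      by simp
    from has_vector_derivative_transform[OF t eq this]
    have "(?F has_vector_derivative f t) (at t within {-N..N})"
      by simp
    moreover have "at t within {-N..N} = at t"
      by (rule at_within_interior) (auto simp: N_def)
    ultimately show ?thesis
      by simp
  qed
  then show ?thesis
    by (intro exI[of _ ?F]) simp
qed

lemma antiderivative_exists:
  fixes f :: "real \<Rightarrow> 'a::{real_normed_vector,complete_space}"
  assumes f: "continuous_on UNIV f"
  shows "\<exists>F. F 0 = 0 \<and> (\<forall>t. (F has_vector_derivative f t) (at t))"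
proof -
  from antiderivative_exists_banach
      [OF bounded_linear.continuous_on[OF bounded_linear_const_bcontfun f]]
  obtain F :: "real \<Rightarrow> (real \<Rightarrow>\<^sub>C 'a)" where F0: "F 0 = 0"
    and F: "\<And>t. (F has_vector_derivative const_bcontfun (f t)) (at t)" by metis
  have "((\<lambda>t. apply_bcontfun (F t) 0) has_vector_derivative f t) (at t)" for t
    using bounded_linear.has_vector_derivative[OF bounded_linear_eval_bcontfun F[of t]]
    by (simp add: const_bcontfun.rep_eq)
  then show ?thesis
    by (intro exI[of _ "\<lambda>t. apply_bcontfun (F t) 0"]) (simp add: F0)
qed

text \<open>The squared norm is differentiable even where the norm is not, and its product with
  \<open>exp (- (2 * L * t))\<close> has nonpositive derivative by Cauchy-Schwarz. Derivatives are
  required only in the open interval, which suits curves with one-sided derivatives at the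
  endpoints.\<close>

lemma gronwall_norm:
  fixes d :: "real \<Rightarrow> 'a::real_inner"
  assumes "0 \<le> T" and cont: "continuous_on {0..T} d"
    and deriv: "\<And>t. 0 < t \<Longrightarrow> t < T \<Longrightarrow> (d has_vector_derivative d' t) (at t)"
    and bound: "\<And>t. 0 < t \<Longrightarrow> t < T \<Longrightarrow> norm (d' t) \<le> L * norm (d t)"
  shows "norm (d T) \<le> exp (L * T) * norm (d 0)"
proof -
  let ?\<phi> = "\<lambda>t. exp (- (2 * L * t)) * (d t \<bullet> d t)"
  have "?\<phi> T \<le> ?\<phi> 0"
  proof (rule DERIV_nonpos_imp_decreasing_open[OF \<open>0 \<le> T\<close>])
    fix t assume t: "0 < t" "t < T"
    have "((\<lambda>t. d t \<bullet> d t) has_real_derivative 2 * (d' t \<bullet> d t)) (at t)"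
      using has_derivative_inner[OF deriv[OF t, unfolded has_vector_derivative_def]
          deriv[OF t, unfolded has_vector_derivative_def]]
      unfolding has_field_derivative_def
      by (rule has_derivative_eq_rhs) (auto simp: inner_commute[of "d t"])
    then have "(?\<phi> has_real_derivative
        exp (- (2 * L * t)) * (2 * (d' t \<bullet> d t)) - (2 * L) * exp (- (2 * L * t)) * (d t \<bullet> d t)) (at t)"
      by (auto intro!: derivative_eq_intros)
    moreover have "d' t \<bullet> d t \<le> L * (d t \<bullet> d t)"
    proof -
      have "d' t \<bullet> d t \<le> norm (d' t) * norm (d t)"
        by (rule norm_cauchy_schwarz)
      also have "\<dots> \<le> L * norm (d t) * norm (d t)"
        by (intro mult_right_mono bound t) simp
      finally show ?thesis by (simp add: dot_square_norm power2_eq_square)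
    qed
    ultimately show "\<exists>y. (?\<phi> has_real_derivative y) (at t) \<and> y \<le> 0"
      by (auto simp: algebra_simps intro!: exI)
  qed (intro continuous_intros cont)
  then have "d T \<bullet> d T \<le> exp (2 * L * T) * (d 0 \<bullet> d 0)"
    by (simp add: exp_minus field_simps)
  also have "\<dots> = (exp (L * T) * norm (d 0))\<^sup>2"
    unfolding power_mult_distrib dot_square_norm exp_double[symmetric] by (simp add: mult.assoc)
  finally have "(norm (d T))\<^sup>2 \<le> (exp (L * T) * norm (d 0))\<^sup>2"
    by (simp only: dot_square_norm)
  then show ?thesis
    by (rule power2_le_imp_le) simp
qed

section \<open>Lipschitz differential equations\<close>

text \<open>A mean value inequality on \<open>closed_segment\<close>, so that one statement serves
  positive and negative times.\<close>

lemma norm_diff_le_derivative_bound: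
  fixes f :: "real \<Rightarrow> 'a::real_normed_vector"
  assumes "\<And>x. x \<in> closed_segment a b \<Longrightarrow>
      (f has_vector_derivative f' x) (at x within closed_segment a b)"
    and "\<And>x. x \<in> closed_segment a b \<Longrightarrow> norm (f' x) \<le> K"
  shows "norm (f b - f a) \<le> K * \<bar>b - a\<bar>"
proof -
  have "onorm (\<lambda>h. h *\<^sub>R f' x) \<le> K" if "x \<in> closed_segment a b" for x
    using assms(2)[OF that] onorm_scaleR_left[OF bounded_linear_ident, of "f' x"]
    by (simp add: onorm_id)
  from differentiable_bound[where S = "closed_segment a b" and f' = "\<lambda>x h. h *\<^sub>R f' x",
      OF convex_closed_segment assms(1)[unfolded has_vector_derivative_def] this, of b a]
  show ?thesis
    by simp
qed

lemma gronwall_norm_abs: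
  fixes d :: "real \<Rightarrow> 'a::real_inner"
  assumes deriv: "\<And>t. (d has_vector_derivative d' t) (at t)"
    and bound: "\<And>t. norm (d' t) \<le> L * norm (d t)"
  shows "norm (d t) \<le> exp (L * \<bar>t\<bar>) * norm (d 0)"
proof (cases "0 \<le> t")
  case True
  have "continuous_on {0..t} d"
    by (rule continuous_on_vector_derivative) (rule has_vector_derivative_at_within[OF deriv])
  from gronwall_norm[OF True this deriv bound] True show ?thesis
    by simp
next
  case False
  have neg: "((\<lambda>s. d (- s)) has_vector_derivative - d' (- s)) (at s)" for s
    using vector_diff_chain_at[of uminus "-1" s d "d' (- s)"] deriv[of "- s"]
    by (simp add: o_def has_vector_derivative_minus has_vector_derivative_id)
  have "continuous_on {0..-t} (\<lambda>s. d (- s))"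
    by (rule continuous_on_vector_derivative) (rule has_vector_derivative_at_within[OF neg])
  from gronwall_norm[OF _ this neg, of L] False bound show ?thesis
    by simp
qed

text \<open>Integrating the weight from 0 reproduces it with a factor \<open>1 / c\<close>. This
  gain is what makes the Picard operator a contraction without any restriction on the time
  interval.\<close>

lemma norm_diff_le_exp_derivative_bound:
  fixes f :: "real \<Rightarrow> 'a::real_normed_vector"
  assumes deriv: "\<And>t. (f has_vector_derivative f' t) (at t)"
    and bound: "\<And>t. norm (f' t) \<le> K * exp (c * \<bar>t\<bar>)" and "0 < c"
  shows "norm (f t - f 0) \<le> K / c * exp (c * \<bar>t\<bar>)"
proof -
  have K: "0 \<le> K"
    using norm_ge_zero[of "f' 0"] bound[of 0] by (simp del: norm_ge_zero)
  have *: "norm (g x - g 0) \<le> K / c * exp (c * x)"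
    if "0 < x" and g: "\<And>t. (g has_vector_derivative g' t) (at t)"
      and g': "\<And>t. norm (g' t) \<le> K * exp (c * \<bar>t\<bar>)" for x :: real and g g' :: "real \<Rightarrow> 'a"
  proof -
    have "norm (g x - g 0) \<le> K / c * exp (c * x) - K / c * exp (c * 0)"
    proof (rule differentiable_bound_general[OF \<open>0 < x\<close> _ _ g])
      show "continuous_on {0..x} g"
        by (rule continuous_on_vector_derivative) (rule has_vector_derivative_at_within[OF g])
      show "((\<lambda>x. K / c * exp (c * x)) has_vector_derivative K * exp (c * t)) (at t)" for t
        using \<open>0 < c\<close>
        by (auto intro!: derivative_eq_intros simp flip: has_real_derivative_iff_has_vector_derivative)
      show "norm (g' t) \<le> K * exp (c * t)" if "0 < t" for t
        using g'[of t] that by simp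
    qed (intro continuous_intros)
    moreover have "0 \<le> K / c"
      using K \<open>0 < c\<close> by simp
    ultimately show ?thesis by simp
  qed
  have neg: "((\<lambda>s. f (- s)) has_vector_derivative - f' (- s)) (at s)" for s
    using vector_diff_chain_at[of uminus "-1" s f "f' (- s)"] deriv[of "- s"]
    by (simp add: o_def has_vector_derivative_minus has_vector_derivative_id)
  consider "t = 0" | "0 < t" | "0 < - t" by linarith
  then show ?thesis
  proof cases
    case 1
    with K \<open>0 < c\<close> show ?thesis by simp
  next
    case 2
    from *[OF this deriv bound] 2 show ?thesis by simp
  next
    case 3
    have "norm (- f' (- s)) \<le> K * exp (c * \<bar>s\<bar>)" for s
      using bound[of "- s"] by simp
    from *[OF 3 neg this] 3 show ?thesis by simp
  qed
qed

lemma lipschitz_ode_exists: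
  fixes F :: "'a::{real_normed_vector,complete_space} \<Rightarrow> 'a"
  assumes "0 \<le> L" and lip: "\<And>u w. norm (F u - F w) \<le> L * norm (u - w)"
  shows "\<exists>w. w 0 = w0 \<and> (\<forall>t. (w has_vector_derivative F (w t)) (at t))"
proof -
  text \<open>
    With the weight \<open>exp (c * \<bar>t\<bar>)\<close>, \<open>c > L\<close>, the Picard operator is a contraction on the
    whole real line.
  \<close>
  define c where "c = L + 1"
  have c: "0 < c" "L < c" using \<open>0 \<le> L\<close> by (auto simp: c_def)
  have F_cont: "continuous_on UNIV F"
    using lipschitz_on_continuous_on[of L UNIV F] lip \<open>0 \<le> L\<close>
    by (auto simp: lipschitz_on_def dist_norm)
  \<comment> \<open>\<open>y z\<close> is the candidate solution; the bounded function
    \<open>z\<close> is the unknown, and the weight carries the exponential growth.\<close>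
  define y :: "(real \<Rightarrow>\<^sub>C 'a) \<Rightarrow> real \<Rightarrow> 'a"
    where "y z t = w0 + exp (c * \<bar>t\<bar>) *\<^sub>R apply_bcontfun z t" for z t
  have "continuous_on UNIV (\<lambda>t. F (y z t))" for z
    unfolding y_def by (intro continuous_on_compose2[OF F_cont] continuous_intros) auto
  from antiderivative_exists[OF this]
  obtain I where I0: "I z 0 = 0" and I: "\<And>t. (I z has_vector_derivative F (y z t)) (at t)" for z
    by metis
  have I_bound: "norm (exp (- (c * \<bar>t\<bar>)) *\<^sub>R I z t) \<le> (norm (F w0) + L * norm z) / c" for z t
  proof -
    have "norm (F (y z t)) \<le> (norm (F w0) + L * norm z) * exp (c * \<bar>t\<bar>)" for t
    proof -
      have "norm (F (y z t)) \<le> norm (F w0) + norm (F (y z t) - F w0)"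
        using norm_triangle_sub[of "F (y z t)" "F w0"] by simp
      also have "norm (F (y z t) - F w0) \<le> L * (exp (c * \<bar>t\<bar>) * norm (apply_bcontfun z t))"
        using lip[of "y z t" w0] by (simp add: y_def)
      also have "\<dots> \<le> L * (exp (c * \<bar>t\<bar>) * norm z)"
        using \<open>0 \<le> L\<close> by (intro mult_left_mono norm_bounded) auto
      also have "norm (F w0) \<le> norm (F w0) * exp (c * \<bar>t\<bar>)"
        using c mult_left_mono[of 1 "exp (c * \<bar>t\<bar>)" "norm (F w0)"] by simp
      finally show ?thesis by (simp add: algebra_simps)
    qed
    from norm_diff_le_exp_derivative_bound[OF I this c(1), of t]
    show ?thesis by (simp add: I0 exp_minus field_simps)
  qed
  \<comment> \<open>The Picard operator read in terms of \<open>z\<close>: integrate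
    \<open>F (y z t)\<close>, then divide by the weight. \<open>I_bound\<close> keeps the result
    bounded.\<close>
  define G :: "(real \<Rightarrow>\<^sub>C 'a) \<Rightarrow> (real \<Rightarrow>\<^sub>C 'a)"
    where "G z = Bcontfun (\<lambda>t. exp (- (c * \<bar>t\<bar>)) *\<^sub>R I z t)" for z
  have G: "apply_bcontfun (G z) t = exp (- (c * \<bar>t\<bar>)) *\<^sub>R I z t" for z t
  proof -
    have "continuous_on UNIV (I z)"
      by (rule continuous_on_vector_derivative) (rule has_vector_derivative_at_within[OF I])
    then have "(\<lambda>t. exp (- (c * \<bar>t\<bar>)) *\<^sub>R I z t) \<in> bcontfun"
      by (intro bcontfun_normI[OF _ I_bound] continuous_intros)
    then show ?thesis by (simp add: G_def Bcontfun_inverse)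
  qed
  have "dist (G z) (G z') \<le> L / c * dist z z'" for z z'
  proof (rule dist_bound)
    fix t
    have deriv: "((\<lambda>t. I z t - I z' t) has_vector_derivative F (y z t) - F (y z' t)) (at t)" for t
      by (intro has_vector_derivative_diff I)
    have "norm (F (y z t) - F (y z' t)) \<le> (L * dist z z') * exp (c * \<bar>t\<bar>)" for t
    proof -
      have "y z t - y z' t = exp (c * \<bar>t\<bar>) *\<^sub>R (apply_bcontfun z t - apply_bcontfun z' t)"
        by (simp add: y_def algebra_simps)
      then have "norm (F (y z t) - F (y z' t))
          \<le> L * (exp (c * \<bar>t\<bar>) * dist (apply_bcontfun z t) (apply_bcontfun z' t))"
        using lip[of "y z t" "y z' t"] by (simp add: dist_norm)
      also have "\<dots> \<le> L * (exp (c * \<bar>t\<bar>) * dist z z')"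
        using \<open>0 \<le> L\<close> by (intro mult_left_mono dist_bounded) auto
      finally show ?thesis by (simp add: mult_ac)
    qed
    from norm_diff_le_exp_derivative_bound[OF deriv this c(1), of t]
    have "norm (I z t - I z' t) \<le> L * dist z z' / c * exp (c * \<bar>t\<bar>)"
      by (simp add: I0)
    moreover have "dist (apply_bcontfun (G z) t) (apply_bcontfun (G z') t)
        = norm (I z t - I z' t) / exp (c * \<bar>t\<bar>)"
      unfolding G dist_norm scaleR_diff_right[symmetric] by (simp add: exp_minus divide_inverse)
    ultimately show "dist (apply_bcontfun (G z) t) (apply_bcontfun (G z') t) \<le> L / c * dist z z'"
      by (simp add: divide_le_eq)
  qed
  then obtain z where z: "G z = z"
    using banach_fix_type[of "L / c" G] c \<open>0 \<le> L\<close> by auto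
  have "y z t = w0 + I z t" for t
    using G[of z t] by (simp add: y_def z exp_minus)
  then have y: "y z = (\<lambda>t. w0 + I z t)" by auto
  have "(y z has_vector_derivative F (y z t)) (at t)" for t
    using has_vector_derivative_add[OF has_vector_derivative_const I[of z t], of w0]
    by (simp add: y)
  then show ?thesis
    by (intro exI[of _ "y z"]) (simp add: y I0)
qed

section \<open>The flow of the Lipschitz nonlinearity\<close>

locale nonlinear_flow =
  fixes J B :: "'a::{real_inner,complete_space} \<Rightarrow> 'a" and L :: real
  assumes J: "cstruct J" and L: "0 \<le> L"
    and lip: "norm (B u - B w) \<le> L * norm (u - w)" and B_zero: "B 0 = 0"
begin

lemma norm_J: "norm (J x) = norm x"
  using J by (simp add: cstruct_def norm_eq_sqrt_inner)

lemma bounded_linear_J: "bounded_linear J"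
  using J norm_J
  by (intro bounded_linear_intro[where K = 1])
     (auto simp: cstruct_def linear_add linear_scale)

lemma norm_B: "norm (B u) \<le> L * norm u"
  using lip[of u 0] by (simp add: B_zero)

lemma continuous_B: "continuous_on S B"
  using lipschitz_on_continuous_on[of L S B] lip L
  by (auto simp: lipschitz_on_def dist_norm)

lemma J_simps: "J (x - y) = J x - J y" "J (x + y) = J x + J y" "J (r *\<^sub>R x) = r *\<^sub>R J x" "J (- x) = - J x"
  using bounded_linear_J[THEN bounded_linear.linear]
  by (simp_all add: linear_diff linear_add linear_scale linear_neg)

text \<open>Replaces the definite description in \<open>PhiB\<close> by a solution curve: existence
  is the weighted Picard argument, uniqueness is Gronwall for the difference of two
  solutions.\<close>

lemma PhiB_solution:
  "\<exists>w. w 0 = w0 \<and> (\<forall>t. (w has_vector_derivative - J (B (w t))) (at t)) \<and> (\<forall>t. PhiB J B t w0 = w t)"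
proof -
  have lip': "norm (- J (B u) - - J (B w)) \<le> L * norm (u - w)" for u w
    using lip[of w u] by (simp add: norm_J norm_minus_commute flip: J_simps)
  obtain w where w: "w 0 = w0" "\<And>t. (w has_vector_derivative - J (B (w t))) (at t)"
    using lipschitz_ode_exists[of L "\<lambda>u. - J (B u)" w0] lip' L by blast
  have "v t = w t" if v: "v 0 = w0" "\<And>t. (v has_vector_derivative - J (B (v t))) (at t)" for v t
    using gronwall_norm_abs[OF has_vector_derivative_diff[OF v(2) w(2)] lip', of t] v(1) w(1)
    by simp
  then have "PhiB J B t w0 = w t" for t
    unfolding PhiB_def by (intro the_equality) (use w in blast)+
  with w show ?thesis by blast
qed

lemma norm_PhiB: "norm (PhiB J B t w) \<le> exp (L * \<bar>t\<bar>) * norm w"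
proof -
  obtain v where v: "v 0 = w" "\<And>t. (v has_vector_derivative - J (B (v t))) (at t)"
    "\<And>t. PhiB J B t w = v t"
    using PhiB_solution[of w] by blast
  show ?thesis
    using gronwall_norm_abs[OF v(2), of L t] norm_B by (simp add: v norm_J)
qed

lemma norm_PhiB_diff: "norm (PhiB J B t w - w) \<le> L * exp (L * \<bar>t\<bar>) * norm w * \<bar>t\<bar>"
proof -
  obtain v where v: "v 0 = w" "\<And>t. (v has_vector_derivative - J (B (v t))) (at t)"
    "\<And>t. PhiB J B t w = v t"
    using PhiB_solution[of w] by blast
  have "norm (v t - v 0) \<le> L * exp (L * \<bar>t\<bar>) * norm w * \<bar>t - 0\<bar>"
  proof (rule norm_diff_le_derivative_bound[OF has_vector_derivative_at_within[OF v(2)]])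
    fix s assume "s \<in> closed_segment 0 t"
    then have s: "\<bar>s\<bar> \<le> \<bar>t\<bar>"
      by (auto simp: closed_segment_eq_real_ivl split: if_splits)
    have "norm (- J (B (v s))) \<le> L * norm (v s)"
      using norm_B by (simp add: norm_J)
    also have "\<dots> \<le> L * (exp (L * \<bar>s\<bar>) * norm w)"
      using norm_PhiB[of s w] L by (intro mult_left_mono) (simp_all add: v)
    also have "\<dots> \<le> L * (exp (L * \<bar>t\<bar>) * norm w)"
      using s L by (auto intro!: mult_mono)
    finally show "norm (- J (B (v s))) \<le> L * exp (L * \<bar>t\<bar>) * norm w"
      by (simp add: mult_ac)
  qed
  then show ?thesis by (simp add: v)
qed

text \<open>Second order without differentiability of \<open>B\<close>: the curve
  \<open>v s + s *\<^sub>R J (B w)\<close> has derivative \<open>J (B w - B (v s))\<close>, which is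
  already O(s) by the Lipschitz condition.\<close>

lemma norm_PhiB_taylor:
  "norm (PhiB J B t w - w + t *\<^sub>R J (B w)) \<le> L\<^sup>2 * exp (L * \<bar>t\<bar>) * norm w * t\<^sup>2"
proof -
  obtain v where v: "v 0 = w" "\<And>t. (v has_vector_derivative - J (B (v t))) (at t)"
    "\<And>t. PhiB J B t w = v t"
    using PhiB_solution[of w] by blast
  let ?f = "\<lambda>s. v s + s *\<^sub>R J (B w)"
  have "norm (?f t - ?f 0) \<le> L\<^sup>2 * exp (L * \<bar>t\<bar>) * norm w * \<bar>t\<bar> * \<bar>t - 0\<bar>"
  proof (rule norm_diff_le_derivative_bound)
    fix s assume "s \<in> closed_segment 0 t"
    then have s: "\<bar>s\<bar> \<le> \<bar>t\<bar>"
      by (auto simp: closed_segment_eq_real_ivl split: if_splits)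
    show "(?f has_vector_derivative - J (B (v s)) + J (B w)) (at s within closed_segment 0 t)"
      by (auto intro!: derivative_eq_intros has_vector_derivative_at_within[OF v(2)])
    have "norm (- J (B (v s)) + J (B w)) = norm (B w - B (v s))"
      by (simp add: norm_J flip: J_simps)
    also have "\<dots> \<le> L * norm (v s - w)"
      using lip[of w "v s"] by (simp add: norm_minus_commute)
    also have "\<dots> \<le> L * (L * exp (L * \<bar>s\<bar>) * norm w * \<bar>s\<bar>)"
      using norm_PhiB_diff[of s w] L by (intro mult_left_mono) (simp_all add: v)
    also have "\<dots> \<le> L * (L * exp (L * \<bar>t\<bar>) * norm w * \<bar>t\<bar>)"
      using s L by (auto intro!: mult_mono)
    finally show "norm (- J (B (v s)) + J (B w)) \<le> L\<^sup>2 * exp (L * \<bar>t\<bar>) * norm w * \<bar>t\<bar>"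
      by (simp add: mult_ac power2_eq_square)
  qed
  moreover have "?f t - ?f 0 = PhiB J B t w - w + t *\<^sub>R J (B w)"
    by (simp add: v)
  moreover have "\<bar>t\<bar> * \<bar>t - 0\<bar> = t\<^sup>2"
    by (simp add: power2_eq_square)
  ultimately show ?thesis
    by (simp only: mult.assoc)
qed

end

section \<open>Spectral projections and the unitary group\<close>

lemma cstruct_skew:
  assumes "cstruct J"
  shows "J x \<bullet> y = - (x \<bullet> J y)"
proof -
  have "x \<bullet> J y = J x \<bullet> J (J y)"
    using assms unfolding cstruct_def by metis
  also have "J (J y) = - y"
    using assms unfolding cstruct_def by metis
  finally show ?thesis
    by simp
qed

section \<open>Projection-valued measures and the scalar measures they induce\<close>

locale pvm_on =
  fixes J :: "'a::real_inner \<Rightarrow> 'a" and E :: "real set \<Rightarrow> 'a \<Rightarrow> 'a"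
  assumes pvm: "pvm J E"
begin

lemma bounded_linear_E: "S \<in> sets borel \<Longrightarrow> bounded_linear (E S)"
  and E_idem: "S \<in> sets borel \<Longrightarrow> E S (E S x) = E S x"
  and E_sym: "S \<in> sets borel \<Longrightarrow> E S x \<bullet> y = x \<bullet> E S y"
  and E_J: "S \<in> sets borel \<Longrightarrow> E S (J x) = J (E S x)"
  and E_UNIV: "E UNIV x = x"
  and E_Int: "S \<in> sets borel \<Longrightarrow> T \<in> sets borel \<Longrightarrow> E (S \<inter> T) x = E S (E T x)"
  and E_sums: "range F \<subseteq> sets borel \<Longrightarrow> disjoint_family F \<Longrightarrow>
      (\<lambda>i. E (F i) x) sums E (\<Union>i. F i) x"
  using pvm unfolding pvm_def sums_def by blast+

text \<open>Empty sets form a disjoint family, and a convergent series with constant terms has terms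
  0.\<close>

lemma E_empty: "E {} x = 0"
proof -
  have "(\<lambda>i::nat. E {} x) sums E (\<Union>i::nat. {}) x"
    by (rule E_sums) (auto simp: disjoint_family_on_def)
  then have "(\<lambda>i::nat. E {} x) \<longlonglongrightarrow> 0"
    using sums_summable summable_LIMSEQ_zero by blast
  then show ?thesis
    by (simp add: LIMSEQ_const_iff)
qed

lemma E_disjoint_Un:
  assumes "S \<in> sets borel" "T \<in> sets borel" "S \<inter> T = {}"
  shows "E (S \<union> T) x = E S x + E T x"
proof -
  have "(\<lambda>i. E (binaryset S T i) x) sums E (\<Union>i. binaryset S T i) x"
    using assms by (intro E_sums) (auto simp: binaryset_def disjoint_family_on_def)
  moreover have "(\<lambda>i. E (binaryset S T i) x) sums (E S x + E T x)"
    using sums_finite[of "{0, 1}" "\<lambda>i. E (binaryset S T i) x"]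
    by (simp add: binaryset_def E_empty)
  ultimately show ?thesis
    by (simp add: UN_binaryset_eq sums_unique2)
qed

lemma E_compl: "S \<in> sets borel \<Longrightarrow> E (- S) x = x - E S x"
  using E_disjoint_Un[of S "- S" x] by (simp add: E_UNIV Compl_partition algebra_simps)

lemma E_compl_E: "S \<in> sets borel \<Longrightarrow> E (- S) (E S x) = 0" "S \<in> sets borel \<Longrightarrow> E S (E (- S) x) = 0"
  using E_Int[of "- S" S x] E_Int[of S "- S" x] by (simp_all add: E_empty)

lemma norm_E_le: "S \<in> sets borel \<Longrightarrow> norm (E S x) \<le> norm x"
proof -
  assume S: "S \<in> sets borel"
  have "norm (E S x) * norm (E S x) = E S x \<bullet> x"
    using E_sym[OF S, of "E S x" x] E_idem[OF S] by (simp add: dot_square_norm flip: power2_eq_square)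
  also have "\<dots> \<le> norm (E S x) * norm x"
    by (rule norm_cauchy_schwarz)
  finally show ?thesis
    by (cases "norm (E S x) = 0") (simp_all add: mult_le_cancel_left_pos)
qed

lemma E_inner_nonneg: "S \<in> sets borel \<Longrightarrow> 0 \<le> E S x \<bullet> x"
  using E_sym[of S "E S x" x] E_idem[of S x] by (simp add: dot_square_norm)

lemma sets_spec_meas [simp, measurable_cong]: "sets (spec_meas E x) = sets borel"
  using sets.sigma_sets_eq[of "borel :: real measure"] by (simp add: spec_meas_def)

lemma space_spec_meas [simp]: "space (spec_meas E x) = UNIV"
  by (simp add: spec_meas_def space_measure_of_conv)

text \<open>\<open>measure_of\<close> returns the prescribed set function only if that function is a
  measure; countable additivity comes from pairing the vector-valued series with
  \<open>x\<close>.\<close>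

lemma emeasure_spec_meas:
  assumes "S \<in> sets borel"
  shows "emeasure (spec_meas E x) S = ennreal (E S x \<bullet> x)"
  unfolding spec_meas_def
proof (rule emeasure_measure_of_sigma)
  show "sigma_algebra UNIV (sets borel :: real set set)"
    using sets.sigma_algebra_axioms[of "borel :: real measure"] by simp
  show "positive (sets borel) (\<lambda>S. ennreal (E S x \<bullet> x))"
    by (simp add: positive_def E_empty)
  show "countably_additive (sets borel) (\<lambda>S. ennreal (E S x \<bullet> x))"
    unfolding countably_additive_def
  proof (intro allI impI)
    fix F :: "nat \<Rightarrow> real set"
    assume F: "range F \<subseteq> sets borel" "disjoint_family F"
    have "(\<lambda>i. E (F i) x \<bullet> x) sums (E (\<Union>i. F i) x \<bullet> x)"
      by (rule bounded_linear.sums[OF bounded_linear_inner_left E_sums[OF F]])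
    then show "(\<Sum>i. ennreal (E (F i) x \<bullet> x)) = ennreal (E (\<Union> (range F)) x \<bullet> x)"
      using F by (intro suminf_ennreal_eq E_inner_nonneg) auto
  qed
qed fact

lemma finite_measure_spec_meas: "finite_measure (spec_meas E x)"
  by (rule finite_measureI) (simp add: emeasure_spec_meas)

text \<open>Projecting the vector restricts its scalar measure, since
  \<open>E T (E S x) \<bullet> E S x = E (S \<inter> T) x \<bullet> x\<close>. Domain membership and
  the quadratic form of \<open>E S x\<close> can thus be read off from those of
  \<open>x\<close>.\<close>

lemma spec_meas_E:
  assumes S: "S \<in> sets borel"
  shows "spec_meas E (E S x) = density (spec_meas E x) (indicator S)"
proof (rule measure_eqI)
  fix T assume "T \<in> sets (spec_meas E (E S x))"
  then have T: "T \<in> sets borel" by simp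
  have "E T (E S x) \<bullet> E S x = E (S \<inter> T) x \<bullet> x"
    using E_sym[OF S, of "E T (E S x)" x] E_sym[OF T, of "E S x" "E S x"] S T
      E_Int[of S T "E S x"] E_Int[of T S "x"] E_Int[of "S \<inter> T" S x]
    by (simp add: Int_absorb2 Int_commute inf.left_commute inf_assoc)
  then show "emeasure (spec_meas E (E S x)) T = emeasure (density (spec_meas E x) (indicator S)) T"
    using S T by (simp add: emeasure_restricted emeasure_spec_meas)
qed simp

end

section \<open>Commutation of the operator with its spectral projections, and the spectral
  tail\<close>

locale selfadjoint_spectral = pvm_on J E
  for J :: "'a::real_inner \<Rightarrow> 'a" and E +
  fixes D :: "'a set" and A :: "'a \<Rightarrow> 'a"
  assumes cstruct: "cstruct J" and selfadj: "selfadjoint_op J D A"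
    and spectral: "spectral_measure_of J D A E"
begin

lemma D_subspace: "subspace D"
  and D_J: "x \<in> D \<Longrightarrow> J x \<in> D"
  and D_dense: "closure D = UNIV"
  and A_add: "x \<in> D \<Longrightarrow> y \<in> D \<Longrightarrow> A (x + y) = A x + A y"
  and A_scale: "x \<in> D \<Longrightarrow> A (c *\<^sub>R x) = c *\<^sub>R A x"
  and A_J: "x \<in> D \<Longrightarrow> A (J x) = J (A x)"
  and A_sym: "x \<in> D \<Longrightarrow> y \<in> D \<Longrightarrow> A x \<bullet> y = x \<bullet> A y"
  using selfadj unfolding selfadjoint_op_def by blast+

lemma A_diff: "x \<in> D \<Longrightarrow> y \<in> D \<Longrightarrow> A (x - y) = A x - A y"
  using A_add[of x "-1 *\<^sub>R y"] A_scale[of y "-1"] subspace_scale[OF D_subspace, of y "-1"] by simp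

lemma orthogonal_D_eq_0:
  assumes "\<And>y. y \<in> D \<Longrightarrow> v \<bullet> y = 0"
  shows "v = 0"
proof -
  have "closed {y. v \<bullet> y = 0}"
    by (intro closed_Collect_eq continuous_intros)
  then have "closure D \<subseteq> {y. v \<bullet> y = 0}"
    using assms by (intro closure_minimal) auto
  then have "v \<bullet> v = 0"
    unfolding D_dense by blast
  then show ?thesis
    by simp
qed

lemma D_iff: "x \<in> D \<longleftrightarrow> integrable (spec_meas E x) (\<lambda>l. l\<^sup>2)"
  and A_inner: "x \<in> D \<Longrightarrow> A x \<bullet> x = integral\<^sup>L (spec_meas E x) (\<lambda>l. l)"
  using spectral unfolding spectral_measure_of_def by blast+

lemma integrable_spec_meas:
  assumes "x \<in> D"
  shows "integrable (spec_meas E x) (\<lambda>l. l)"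
proof (rule Bochner_Integration.integrable_bound)
  interpret finite_measure "spec_meas E x" by (rule finite_measure_spec_meas)
  show "integrable (spec_meas E x) (\<lambda>l. 1 + l\<^sup>2)"
    using assms by (auto simp: D_iff)
  have "\<bar>l\<bar> \<le> 1 + l\<^sup>2" for l :: real
    using zero_le_power2[of "\<bar>l\<bar> - 1"] by (simp add: power2_diff)
  then show "AE l in spec_meas E x. norm l \<le> norm (1 + l\<^sup>2)"
    by auto
qed simp

lemma E_in_D:
  assumes S: "S \<in> sets borel" and x: "x \<in> D"
  shows "E S x \<in> D"
proof -
  have "integrable (density (spec_meas E x) (\<lambda>l. ennreal (indicator S l))) (\<lambda>l. l\<^sup>2)"
    using S x by (subst integrable_density) (auto simp: D_iff intro: integrable_real_mult_indicator
        integrable_mult_indicator[where 'b = real, simplified])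
  then show ?thesis
    using S by (simp add: D_iff spec_meas_E ennreal_indicator)
qed

lemma A_inner_E:
  assumes S: "S \<in> sets borel" and x: "x \<in> D"
  shows "A (E S x) \<bullet> E S x = (\<integral>l. indicator S l * l \<partial>spec_meas E x)"
proof -
  have "A (E S x) \<bullet> E S x = integral\<^sup>L (density (spec_meas E x) (\<lambda>l. ennreal (indicator S l))) (\<lambda>l. l)"
    using S x by (simp add: A_inner E_in_D spec_meas_E ennreal_indicator)
  also have "\<dots> = (\<integral>l. indicator S l * l \<partial>spec_meas E x)"
    using S by (subst integral_density) auto
  finally show ?thesis .
qed

text \<open>The integral of \<open>l\<close> splits over \<open>S\<close> and its complement, so the
  quadratic form of \<open>A\<close> has no cross terms for \<open>x = E S x + E (- S) x\<close>.
  The two cross terms are equal by symmetry, hence each is 0.\<close>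

lemma A_E_orthogonal:
  assumes S: "S \<in> sets borel" and x: "x \<in> D"
  shows "A (E S x) \<bullet> E (- S) x = 0"
proof -
  have S': "- S \<in> sets borel" using S by simp
  note D = E_in_D[OF S x] E_in_D[OF S' x]
  have int: "integrable (spec_meas E x) (\<lambda>l. indicator S' l * l)" if "S' \<in> sets borel" for S'
    using integrable_mult_indicator[OF _ integrable_spec_meas[OF x], of S'] that by simp
  have "A x \<bullet> x = (\<integral>l. indicator S l * l + indicator (- S) l * l \<partial>spec_meas E x)"
    unfolding A_inner[OF x] by (intro Bochner_Integration.integral_cong) (auto split: split_indicator)
  also have "\<dots> = A (E S x) \<bullet> E S x + A (E (- S) x) \<bullet> E (- S) x"
    using S S' x by (simp add: A_inner_E int)
  finally have "A x \<bullet> x = A (E S x) \<bullet> E S x + A (E (- S) x) \<bullet> E (- S) x" .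
  moreover have "x = E S x + E (- S) x"
    using S by (simp add: E_compl)
  then have "A x \<bullet> x = (A (E S x) + A (E (- S) x)) \<bullet> (E S x + E (- S) x)"
    using A_add[OF D] by simp
  moreover have "A (E (- S) x) \<bullet> E S x = A (E S x) \<bullet> E (- S) x"
    using A_sym[OF D] by (simp add: inner_commute)
  ultimately show ?thesis
    by (simp add: inner_add_left inner_add_right)
qed

text \<open>Orthogonality is known only for the two parts of one vector. The vector
  \<open>?z\<close> has the \<open>S\<close>-part of \<open>x\<close> and the complementary part of
  an arbitrary \<open>y\<close>, which frees the second argument; density of \<open>D\<close>
  finishes.\<close>

lemma E_compl_A_E:
  assumes S: "S \<in> sets borel" and x: "x \<in> D"
  shows "E (- S) (A (E S x)) = 0"
proof (rule orthogonal_D_eq_0)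
  fix y assume y: "y \<in> D"
  have S': "- S \<in> sets borel" using S by simp
  let ?z = "E S x + E (- S) y"
  have "?z \<in> D"
    using S S' x y by (intro subspace_add D_subspace E_in_D)
  moreover have "E S ?z = E S x" "E (- S) ?z = E (- S) y"
    using S S' E_compl_E[OF S]
    by (simp_all add: linear_add[OF bounded_linear.linear[OF bounded_linear_E]] E_idem)
  ultimately have "A (E S x) \<bullet> E (- S) y = 0"
    using A_E_orthogonal[OF S, of ?z] by simp
  then show "E (- S) (A (E S x)) \<bullet> y = 0"
    using E_sym[OF S'] by simp
qed

text \<open>\<open>E_compl_A_E\<close> for \<open>S\<close> and for \<open>- S\<close> says that
  both ranges are invariant under \<open>A\<close>, so \<open>E S\<close> selects the right summand
  of \<open>A x\<close>.\<close>

lemma A_E: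
  assumes S: "S \<in> sets borel" and x: "x \<in> D"
  shows "A (E S x) = E S (A x)"
proof -
  have S': "- S \<in> sets borel" using S by simp
  note D = E_in_D[OF S x] E_in_D[OF S' x]
  have "A x = A (E S x) + A (E (- S) x)"
    using A_add[OF D] S by (simp add: E_compl)
  then have "E S (A x) = E S (A (E S x)) + E S (A (E (- S) x))"
    by (simp add: linear_add[OF bounded_linear.linear[OF bounded_linear_E[OF S]]])
  also have "E S (A (E (- S) x)) = 0"
    using E_compl_A_E[OF S' x] by simp
  also have "E S (A (E S x)) = A (E S x)"
    using E_compl_A_E[OF S x] by (simp add: E_compl[OF S])
  finally show ?thesis by simp
qed

text \<open>For \<open>a = E S x\<close> the scalar measure lives on \<open>S\<close>, so
  \<open>\<sigma> * (A a \<bullet> a)\<close> is at least \<open>R * (norm a)\<^sup>2\<close>;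
  Cauchy-Schwarz and \<open>A_E\<close> give the rest. The sign \<open>\<sigma>\<close> covers the
  right and the left tail together.\<close>

lemma norm_E_le_norm_A:
  assumes S: "S \<in> sets borel" and x: "x \<in> D"
    and "\<bar>\<sigma>\<bar> = 1" and ge: "\<And>l. l \<in> S \<Longrightarrow> R \<le> \<sigma> * l"
  shows "R * norm (E S x) \<le> norm (A x)"
proof -
  let ?a = "E S x"
  let ?M = "spec_meas E ?a"
  have a: "?a \<in> D" by (rule E_in_D[OF S x])
  interpret finite_measure ?M by (rule finite_measure_spec_meas)
  have S': "- S \<in> sets borel" using S by simp
  have "AE l in ?M. l \<in> S"
  proof (rule AE_I)
    show "emeasure ?M (- S) = 0"
      by (simp add: emeasure_spec_meas S' E_compl_E S)
  qed (use S' in auto)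
  then have "(\<integral>l. R \<partial>?M) \<le> (\<integral>l. \<sigma> * l \<partial>?M)"
    using a integrable_spec_meas ge by (intro integral_mono_AE) auto
  moreover have "measure ?M UNIV = (norm ?a)\<^sup>2"
    by (simp add: measure_def emeasure_spec_meas E_UNIV dot_square_norm)
  ultimately have "R * (norm ?a)\<^sup>2 \<le> \<sigma> * (A ?a \<bullet> ?a)"
    by (simp add: A_inner[OF a] mult.commute)
  also have "\<dots> \<le> \<bar>\<sigma> * (A ?a \<bullet> ?a)\<bar>"
    by simp
  also have "\<dots> \<le> norm (A ?a) * norm ?a"
    using Cauchy_Schwarz_ineq2[of "A ?a" ?a] assms(3) by (simp add: abs_mult)
  also have "\<dots> \<le> norm (A x) * norm ?a"
    using norm_E_le[OF S] by (intro mult_right_mono) (simp_all add: A_E[OF S x])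
  finally have "R * norm ?a * norm ?a \<le> norm (A x) * norm ?a"
    by (simp add: power2_eq_square mult.assoc)
  then show ?thesis
    by (cases "norm ?a = 0") (simp_all add: mult_le_cancel_right_pos)
qed

text \<open>The complement of the interval is two half-lines, each treated with its own sign. Adding
  their norms instead of using orthogonality costs the factor 2.\<close>

lemma spectral_tail:
  assumes x: "x \<in> D"
  shows "R * norm (x - E {-R..R} x) \<le> 2 * norm (A x)"
proof (cases "0 \<le> R")
  case True
  have "- {-R..R} = {..<-R} \<union> {R<..}"
    by auto
  then have "x - E {-R..R} x = E ({..<-R} \<union> {R<..}) x"
    using E_compl[of "{-R..R}" x] by simp
  also have "\<dots> = E {..<-R} x + E {R<..} x"
    using True by (intro E_disjoint_Un) auto
  finally have "R * norm (x - E {-R..R} x) \<le> R * norm (E {..<-R} x) + R * norm (E {R<..} x)"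
    using True norm_triangle_ineq[of "E {..<-R} x" "E {R<..} x"]
    by (simp add: mult_left_mono flip: distrib_left)
  moreover have "R * norm (E {..<-R} x) \<le> norm (A x)"
    using x by (intro norm_E_le_norm_A[where \<sigma> = "-1"]) auto
  moreover have "R * norm (E {R<..} x) \<le> norm (A x)"
    using x by (intro norm_E_le_norm_A[where \<sigma> = 1]) auto
  ultimately show ?thesis by simp
next
  case False
  then have "R * norm (x - E {-R..R} x) \<le> 0"
    by (simp add: mult_nonpos_nonneg)
  then show ?thesis
    by (smt (verit) norm_ge_zero)
qed

end

lemma unitary_group_ofD:
  assumes "unitary_group_of J D A U"
  shows "bounded_linear (U t)" "U t (J x) = J (U t x)" "norm (U t x) = norm x"
    "U 0 x = x" "U (r + t) x = U r (U t x)" "continuous_on S (\<lambda>t. U t x)"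
  using assms unfolding unitary_group_of_def by (blast intro: continuous_on_subset)+

section \<open>Domain invariance under the unitary group and its commutation with the
  projections\<close>

locale unitary_spectral = selfadjoint_spectral +
  fixes U
  assumes unitary: "unitary_group_of J D A U"
begin

lemma U_deriv_0: "x \<in> D \<Longrightarrow> ((\<lambda>t. U t x) has_vector_derivative - J (A x)) (at 0)"
  and D_iff_U: "x \<in> D \<longleftrightarrow> (\<exists>v. ((\<lambda>t. U t x) has_vector_derivative v) (at 0))"
  using unitary unfolding unitary_group_of_def by blast+

lemmas U_group = unitary_group_ofD[OF unitary]

lemma J_linear: "linear J"
  using cstruct by (simp add: cstruct_def)

text \<open>\<open>U t\<close> commutes with \<open>U h\<close>, hence maps the derivative of the
  orbit of \<open>x\<close> at 0 to that of the orbit of \<open>U t x\<close>; the domain is exactly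
  where this derivative exists.\<close>

lemma U_in_D:
  assumes x: "x \<in> D"
  shows "U t x \<in> D" and "J (A (U t x)) = U t (J (A x))"
proof -
  have "((\<lambda>h. U t (U h x)) has_vector_derivative U t (- J (A x))) (at 0)"
    by (rule bounded_linear.has_vector_derivative[OF U_group(1) U_deriv_0[OF x]])
  moreover have "U t (U h x) = U h (U t x)" for h
    using U_group(5)[of t h x] U_group(5)[of h t x] by (simp add: add.commute)
  ultimately have deriv: "((\<lambda>h. U h (U t x)) has_vector_derivative U t (- J (A x))) (at 0)"
    by simp
  then show D: "U t x \<in> D"
    unfolding D_iff_U[of "U t x"] by blast
  have "- J (A (U t x)) = U t (- J (A x))"
    by (rule vector_derivative_unique_at[OF U_deriv_0[OF D] deriv])
  then show "J (A (U t x)) = U t (J (A x))"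
    by (simp add: linear_neg[OF bounded_linear.linear[OF U_group(1)]])
qed

lemma U_deriv:
  assumes x: "x \<in> D"
  shows "((\<lambda>t. U t x) has_vector_derivative - J (A (U t x))) (at t)"
proof -
  have "((\<lambda>s. U s (U t x)) \<circ> (\<lambda>s. s - t) has_vector_derivative 1 *\<^sub>R (- J (A (U t x)))) (at t)"
  proof (rule vector_diff_chain_at)
    show "((\<lambda>s. s - t) has_vector_derivative 1) (at t)"
      by (auto intro!: derivative_eq_intros)
    show "((\<lambda>s. U s (U t x)) has_vector_derivative - J (A (U t x))) (at (t - t))"
      using U_deriv_0[OF U_in_D(1)[OF x]] by simp
  qed
  moreover have "(\<lambda>s. U s (U t x)) \<circ> (\<lambda>s. s - t) = (\<lambda>s. U s x)"
    by (auto simp flip: U_group(5))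
  ultimately show ?thesis by simp
qed

lemma norm_U_diff:
  assumes x: "x \<in> D"
  shows "norm (U t x - x) \<le> norm (A x) * \<bar>t\<bar>"
proof -
  have "norm (U t x - U 0 x) \<le> norm (A x) * \<bar>t - 0\<bar>"
  proof (rule norm_diff_le_derivative_bound[OF has_vector_derivative_at_within[OF U_deriv[OF x]]])
    fix s
    have "norm (J y) = norm y" for y
      using cstruct by (simp add: cstruct_def norm_eq_sqrt_inner)
    then show "norm (- J (A (U s x))) \<le> norm (A x)"
      by (simp add: U_in_D[OF x] U_group(3))
  qed
  then show ?thesis by (simp add: U_group(4))
qed

text \<open>The difference \<open>v\<close> of the two sides solves the linear equation
  \<open>v' = - J (A v)\<close> with \<open>v 0 = 0\<close>, and that equation conserves the
  norm.\<close>

lemma E_U: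
  assumes S: "S \<in> sets borel" and x: "x \<in> D"
  shows "E S (U t x) = U t (E S x)"
proof -
  define v where "v t = E S (U t x) - U t (E S x)" for t
  have v_D: "v t \<in> D" for t
    unfolding v_def by (intro subspace_diff D_subspace E_in_D U_in_D S x)
  have v_deriv: "(v has_vector_derivative - J (A (v t))) (at t)" for t
  proof -
    have "(v has_vector_derivative E S (- J (A (U t x))) - (- J (A (U t (E S x))))) (at t)"
      unfolding v_def[abs_def]
      by (intro has_vector_derivative_diff bounded_linear.has_vector_derivative[OF bounded_linear_E[OF S]]
          U_deriv E_in_D S x)
    also have "E S (- J (A (U t x))) = - J (A (E S (U t x)))"
      by (simp add: linear_neg[OF bounded_linear.linear[OF bounded_linear_E[OF S]]] E_J S A_E
          U_in_D(1)[OF x])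
    finally show ?thesis
      unfolding v_def[abs_def] by (simp add: A_diff E_in_D U_in_D S x linear_diff[OF J_linear])
  qed
  \<comment> \<open>\<open>J\<close> is skew, and \<open>A\<close> is symmetric and commutes with
    \<open>J\<close>, so \<open>J (A y) \<bullet> y\<close> equals its own negative.\<close>
  have "J (A y) \<bullet> y = 0" if "y \<in> D" for y
    using cstruct_skew[OF cstruct, of "A y" y] A_sym[OF that D_J[OF that]] A_J[OF that]
    by (simp add: inner_commute)
  then have "((\<lambda>t. v t \<bullet> v t) has_real_derivative 0) (at t)" for t
    using has_derivative_inner[OF v_deriv[unfolded has_vector_derivative_def]
        v_deriv[unfolded has_vector_derivative_def], of t] v_D
    unfolding has_field_derivative_def
    by (elim has_derivative_eq_rhs) (auto simp: inner_commute[of "v t"])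
  then have "v t \<bullet> v t = v 0 \<bullet> v 0"
    by (rule DERIV_isconst_all[OF allI])
  then show ?thesis
    by (simp add: v_def U_group(4))
qed

end

section \<open>Uniform boundedness and mild solutions\<close>

text \<open>The Banach-Steinhaus argument: the closed sets \<open>S n\<close> cover the space, by
  Baire one of them contains a ball, and \<open>T i ?y = T i (x0 + ?y) - T i x0\<close> moves the
  bound on this ball to the origin.\<close>

lemma uniform_boundedness:
  fixes T :: "'i \<Rightarrow> 'a::{real_normed_vector,complete_space} \<Rightarrow> 'b::real_normed_vector"
  assumes T: "\<And>i. i \<in> I \<Longrightarrow> bounded_linear (T i)"
    and pointwise: "\<And>x. \<exists>K. \<forall>i\<in>I. norm (T i x) \<le> K"
  shows "\<exists>C>0. \<forall>i\<in>I. \<forall>x. norm (T i x) \<le> C * norm x"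
proof -
  define S where "S n = {x. \<forall>i\<in>I. norm (T i x) \<le> real n}" for n
  have closed: "closed (S n)" for n
  proof -
    have "S n = (\<Inter>i\<in>I. {x. norm (T i x) \<le> real n})"
      by (auto simp: S_def)
    also have "closed \<dots>"
      using T by (intro closed_INT ballI closed_Collect_le continuous_intros)
        (simp add: linear_continuous_on)
    finally show ?thesis .
  qed
  have "\<exists>n. x \<in> S n" for x
  proof -
    obtain K where "\<forall>i\<in>I. norm (T i x) \<le> K"
      using pointwise by blast
    moreover obtain n where "K \<le> real n"
      using real_arch_simple by blast
    ultimately have "x \<in> S n"
      unfolding S_def by (auto intro: order_trans)
    then show ?thesis ..
  qed
  then have "\<Union>(range S) = UNIV"
    by auto
  moreover have "euclidean interior_of \<Union>(range S) = {}" if "\<And>n. interior (S n) = {}"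
    using that closed by (intro Baire_category_alt) (auto simp: completely_metrizable_space_euclidean)
  ultimately obtain n x0 where "x0 \<in> interior (S n)"
    by auto
  then obtain r where r: "0 < r" "cball x0 r \<subseteq> S n"
    by (meson mem_interior_cball)
  \<comment> \<open>The ball gives \<open>2 * real n / r\<close>; the added 1 only keeps the
    constant positive when \<open>n = 0\<close>.\<close>
  have "norm (T i x) \<le> (2 * real n / r + 1) * norm x" if i: "i \<in> I" for i x
  proof (cases "x = 0")
    case True
    then show ?thesis
      using T[OF i] by (simp add: linear_0 bounded_linear.linear)
  next
    case False
    let ?y = "(r / norm x) *\<^sub>R x"
    have "x0 + ?y \<in> S n" "x0 \<in> S n"
      using r False by (auto intro!: subsetD[OF r(2)] simp: dist_norm)
    then have "norm (T i (x0 + ?y)) \<le> real n" "norm (T i x0) \<le> real n"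
      using i by (auto simp: S_def)
    moreover have "T i ?y = T i (x0 + ?y) - T i x0"
      using T[OF i] by (simp add: linear_add bounded_linear.linear)
    ultimately have "norm (T i ?y) \<le> 2 * real n"
      by (smt (verit) norm_triangle_ineq4)
    moreover have "norm (T i ?y) = r / norm x * norm (T i x)"
      using T[OF i] r(1) by (simp add: linear_scale bounded_linear.linear)
    ultimately have "norm (T i x) \<le> 2 * real n / r * norm x"
      using r(1) False by (simp add: field_simps)
    then show ?thesis
      by (simp add: distrib_right add_increasing2)
  qed
  moreover have "0 < 2 * real n / r + 1"
    using r(1) by (simp add: add_nonneg_pos)
  ultimately show ?thesis by blast
qed

section \<open>Uniqueness of mild solutions\<close>

locale mild_flow = nonlinear_flow J B L
  for J B :: "'a::{real_inner,complete_space} \<Rightarrow> 'a" and L +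
  fixes D A U
  assumes unitary: "unitary_group_of J D A U"
begin

lemmas U_group = unitary_group_ofD[OF unitary]

lemma U_simps: "U t (x - y) = U t x - U t y" "U t (x + y) = U t x + U t y"
  "U t (r *\<^sub>R x) = r *\<^sub>R U t x" "U t (- x) = - U t x"
  using U_group(1)[THEN bounded_linear.linear]
  by (simp_all add: linear_diff linear_add linear_scale linear_neg)

lemma U_cancel: "U (- t) (U t x) = x" "U t (U (- t) x) = x"
  using U_group(5)[of "- t" t x] U_group(5)[of t "- t" x] by (simp_all add: U_group(4))

text \<open>The group is only strongly continuous; joint continuity follows because each
  \<open>U t\<close> is an isometry, which passes the variation of \<open>f\<close> through
  unchanged.\<close>

lemma continuous_on_U:
  assumes f: "continuous_on S f" and g: "continuous_on S g"
  shows "continuous_on S (\<lambda>s. U (g s) (f s))"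
  unfolding continuous_on_def
proof
  fix x assume x: "x \<in> S"
  have lim: "((\<lambda>s. norm (f s - f x) + norm (U (g s) (f x) - U (g x) (f x))) \<longlongrightarrow> 0) (at x within S)"
  proof (rule tendsto_add_zero)
    show "((\<lambda>s. norm (f s - f x)) \<longlongrightarrow> 0) (at x within S)"
      using bspec[OF f[unfolded continuous_on_def] x] by (rule tendsto_norm_zero[OF LIM_zero])
    have "continuous_on S (\<lambda>s. U (g s) (f x))"
      by (rule continuous_on_compose2[OF U_group(6)[of UNIV] g]) simp
    from bspec[OF this[unfolded continuous_on_def] x]
    show "((\<lambda>s. norm (U (g s) (f x) - U (g x) (f x))) \<longlongrightarrow> 0) (at x within S)"
      by (rule tendsto_norm_zero[OF LIM_zero])
  qed
  have "norm (U (g s) (f s) - U (g x) (f x))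
      \<le> norm (f s - f x) + norm (U (g s) (f x) - U (g x) (f x))" for s
  proof -
    have "U (g s) (f s) - U (g x) (f x) = U (g s) (f s - f x) + (U (g s) (f x) - U (g x) (f x))"
      by (simp add: U_simps)
    then show ?thesis
      using norm_triangle_ineq[of "U (g s) (f s - f x)" "U (g s) (f x) - U (g x) (f x)"]
      by (simp only: U_group(3))
  qed
  then have "((\<lambda>s. U (g s) (f s) - U (g x) (f x)) \<longlongrightarrow> 0) (at x within S)"
    by (intro Lim_null_comparison[OF always_eventually lim] allI)
  then show "((\<lambda>s. U (g s) (f s)) \<longlongrightarrow> U (g x) (f x)) (at x within S)"
    by (rule LIM_zero_cancel)
qed

text \<open>
  In the interaction picture \<open>v t = U (- t) (u t)\<close> a mild solution becomes a classical solution
  of \<open>v' = - J (U (- t) (B (U t v)))\<close>.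
\<close>

lemma mild_sol_interaction:
  assumes u: "mild_sol J U B u0 T u" and a: "a < T" and s: "s \<in> {0..a}"
  shows "((\<lambda>t. U (- t) (u t)) has_vector_derivative - J (U (- s) (B (u s)))) (at s within {0..a})"
proof -
  let ?g = "\<lambda>r. U (- r) (B (u r))"
  have u_cont: "continuous_on {0..a} u"
    using u a unfolding mild_sol_def by (auto intro: continuous_on_subset)
  have g_cont: "continuous_on {0..a} ?g"
    by (intro continuous_on_U continuous_on_compose2[OF continuous_B u_cont] continuous_intros) auto
  have eq: "U (- t) (u t) = u0 - J (integral {0..t} ?g)" if t: "t \<in> {0..a}" for t
  proof -
    have int: "?g integrable_on {0..t}"
      using t by (intro integral_has_vector_derivative_complete continuous_on_subset[OF g_cont]) auto
    \<comment> \<open>\<open>U (t - r)\<close> factors as \<open>U t\<close> after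
      \<open>U (- r)\<close>, so the \<open>t\<close>-dependence leaves the integral and only its
      upper limit remains to be differentiated.\<close>
    have "(\<lambda>r. U (t - r) (B (u r))) = U t \<circ> ?g"
      by (simp add: fun_eq_iff flip: U_group(5))
    then have "integral {0..t} (\<lambda>r. U (t - r) (B (u r))) = U t (integral {0..t} ?g)"
      using integral_linear[OF int U_group(1)] by simp
    moreover have "u t = U t u0 - J (integral {0..t} (\<lambda>r. U (t - r) (B (u r))))"
      using u a t unfolding mild_sol_def by auto
    ultimately have "u t = U t (u0 - J (integral {0..t} ?g))"
      by (simp add: U_simps U_group(2))
    then show ?thesis
      by (simp add: U_cancel)
  qed
  have "((\<lambda>t. u0 - J (integral {0..t} ?g)) has_vector_derivative 0 - J (?g s)) (at s within {0..a})"
    by (intro has_vector_derivative_diff has_vector_derivative_const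
        bounded_linear.has_vector_derivative[OF bounded_linear_J]
        integral_has_vector_derivative_complete(2)[OF g_cont s])
  from has_vector_derivative_transform[OF s eq this]
  show ?thesis by simp
qed

lemma mild_sol_0: "mild_sol J U B u0 T u \<Longrightarrow> 0 < T \<Longrightarrow> u 0 = u0"
  using J_simps(3)[of 0 0] unfolding mild_sol_def by (simp add: U_group(4))

text \<open>Gronwall in the interaction picture: isometry removes the group from both the difference
  and its derivative, leaving the Lipschitz bound of \<open>B\<close>. This makes the description in
  \<open>Phi\<close> well defined.\<close>

lemma mild_sol_unique:
  assumes u: "mild_sol J U B u0 T u" and w: "mild_sol J U B u0 T' w"
    and t: "0 \<le> t" "t < T" "t < T'"
  shows "u t = w t"
proof -
  let ?d = "\<lambda>s. U (- s) (u s) - U (- s) (w s)"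
  let ?d' = "\<lambda>s. - J (U (- s) (B (u s))) - - J (U (- s) (B (w s)))"
  have deriv: "(?d has_vector_derivative ?d' s) (at s within {0..t})" if "s \<in> {0..t}" for s
    using that t by (intro has_vector_derivative_diff mild_sol_interaction[OF u] mild_sol_interaction[OF w])
  have "norm (?d t) \<le> exp (L * t) * norm (?d 0)"
  proof (rule gronwall_norm[OF t(1)])
    show "continuous_on {0..t} ?d"
      by (rule continuous_on_vector_derivative) (rule deriv)
    fix s assume s: "0 < s" "s < t"
    show "(?d has_vector_derivative ?d' s) (at s)"
      using deriv[of s] s by (simp add: at_within_Icc_at)
    have "?d' s = J (U (- s) (B (w s) - B (u s)))"
      by (simp add: U_simps J_simps)
    then have "norm (?d' s) = norm (B (w s) - B (u s))"
      by (simp add: norm_J U_group(3))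
    also have "\<dots> \<le> L * norm (u s - w s)"
      using lip[of "w s" "u s"] by (simp add: norm_minus_commute)
    also have "norm (u s - w s) = norm (?d s)"
      by (simp add: U_group(3) flip: U_simps)
    finally show "norm (?d' s) \<le> L * norm (?d s)" .
  qed
  then have "norm (?d t) = 0"
    using mild_sol_0[OF u] mild_sol_0[OF w] t by simp
  then show ?thesis
    by (simp add: U_group(3) flip: U_simps)
qed

lemma Phi_eq_mild_sol:
  assumes u: "mild_sol J U B u0 T u" and t: "0 \<le> t" "t < T"
  shows "Phi J U B t u0 = u t"
  unfolding Phi_def by (rule the_equality) (use assms mild_sol_unique in blast)+

end

section \<open>Stability and consistency of the splitting scheme\<close>

text \<open>Isolates what the numerical analysis needs from the operator theory. The weak space is
  seen only through \<open>norm (\<iota> x)\<close>; \<open>C0\<close> is the common constant from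
  uniform boundedness, \<open>C1\<close> bounds the embedding, \<open>M\<close> bounds the
  projections.\<close>

locale splitting = mild_flow J B L D A U
  for J B :: "'a::{real_inner,complete_space} \<Rightarrow> 'a" and L D A U +
  fixes \<iota> :: "'a \<Rightarrow> 'h::real_normed_vector" and P :: "real \<Rightarrow> 'a \<Rightarrow> 'a" and C0 C1 M :: real
  assumes \<iota>: "linear \<iota>" and C0: "0 \<le> C0" and C1: "0 \<le> C1" and M: "0 \<le> M"
    and \<iota>_le: "norm (\<iota> x) \<le> C1 * norm x"
    and \<iota>_U: "norm (\<iota> (U t x)) = norm (\<iota> x)"
    and \<iota>_J: "norm (\<iota> (J x)) = norm (\<iota> x)"
    and \<iota>_U_diff: "norm (\<iota> (U t x - x)) \<le> C0 * norm x * \<bar>t\<bar>"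
    and \<iota>_P_diff: "0 < R \<Longrightarrow> R * norm (\<iota> (x - P R x)) \<le> C0 * norm x"
    and P: "0 < R \<Longrightarrow> linear (P R)"
    and norm_P: "0 < R \<Longrightarrow> norm (P R x) \<le> M * norm x"
    and P_idem: "0 < R \<Longrightarrow> P R (P R x) = P R x"
    and P_U: "0 < R \<Longrightarrow> P R (U t x) = U t (P R x)"
    and \<iota>_B_lip: "\<exists>K\<ge>0. \<forall>u w. norm u \<le> r \<and> norm w \<le> r \<longrightarrow> norm (\<iota> (B u - B w)) \<le> K * norm (\<iota> (u - w))"
begin

abbreviation q :: "'a \<Rightarrow> real" where "q x \<equiv> norm (\<iota> x)"

lemma q_add: "q (x + y) \<le> q x + q y"
  using norm_triangle_ineq[of "\<iota> x"] by (simp add: linear_add[OF \<iota>])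

lemma q_diff: "q (x - y) \<le> q x + q y"
  using norm_triangle_ineq4[of "\<iota> x"] by (simp add: linear_diff[OF \<iota>])

lemma q_scale: "q (r *\<^sub>R x) = \<bar>r\<bar> * q x"
  by (simp add: linear_scale[OF \<iota>])

lemma q_zero: "q 0 = 0"
  by (simp add: linear_0[OF \<iota>])

text \<open>Here the lower bound on \<open>R\<close> is spent: the cut-off error of one substep
  becomes as small as a local error.\<close>

lemma \<iota>_P_diff_le:
  assumes "0 < h" "1 / h\<^sup>2 \<le> R"
  shows "q (x - P R x) \<le> C0 * norm x * h\<^sup>2"
proof -
  have "0 < R"
    using assms by (smt (verit) zero_less_divide_1_iff zero_less_power)
  have "1 / h\<^sup>2 * q (x - P R x) \<le> R * q (x - P R x)"
    using assms by (intro mult_right_mono) auto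
  also have "\<dots> \<le> C0 * norm x"
    by (rule \<iota>_P_diff) fact
  finally show ?thesis
    using \<open>0 < h\<close> by (simp add: divide_le_eq)
qed

text \<open>
  The iteration is not estimated in the norm of the space directly, since the powers of
  \<open>M\<close> would accumulate.  In the equivalent norm below every \<open>U t \<circ> P R\<close> is a contraction.
\<close>

definition split_norm :: "real \<Rightarrow> 'a \<Rightarrow> real"
  where "split_norm R x = norm (P R x) + norm (x - P R x)"

lemma norm_le_split_norm: "norm x \<le> split_norm R x"
  using norm_triangle_ineq[of "P R x" "x - P R x"] by (simp add: split_norm_def)

lemma split_norm_le: "0 < R \<Longrightarrow> split_norm R x \<le> (2 * M + 1) * norm x"
  using norm_triangle_ineq4[of x "P R x"] norm_P[of R x] by (simp add: split_norm_def algebra_simps)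

lemma split_norm_add: "0 < R \<Longrightarrow> split_norm R (x + y) \<le> split_norm R x + split_norm R y"
  using norm_triangle_ineq[of "P R x" "P R y"] norm_triangle_ineq[of "x - P R x" "y - P R y"]
  by (simp add: split_norm_def linear_add[OF P] algebra_simps)

text \<open>\<open>U t (P R x)\<close> is fixed by \<open>P R\<close>, so its second summand
  vanishes and the first is \<open>norm (P R x)\<close>, with no factor \<open>M\<close>.\<close>

lemma split_norm_U_P: "0 < R \<Longrightarrow> split_norm R (U t (P R x)) \<le> split_norm R x"
  by (simp add: split_norm_def P_U P_idem U_group(3))

text \<open>The nonlinear flow is treated as identity plus the increment \<open>?g\<close>. Passing
  to \<open>split_norm\<close> costs \<open>2 * M + 1\<close> on the increment alone, which is O(h),
  so the total factor stays \<open>1 + O(h)\<close>.\<close>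

lemma split_norm_substep:
  assumes R: "0 < R" and h: "0 \<le> h" "h \<le> T" and \<beta>: "\<bar>\<beta>\<bar> \<le> b"
  shows "split_norm R (PhiB J B (\<beta> * h) (U t (P R x)))
    \<le> (1 + (2 * M + 1) * L * exp (L * (b * T)) * b * h) * split_norm R x"
proof -
  let ?w = "U t (P R x)"
  let ?g = "PhiB J B (\<beta> * h) ?w - ?w"
  have \<beta>h: "\<bar>\<beta> * h\<bar> \<le> b * h" "b * h \<le> b * T"
    using h \<beta> by (auto simp: abs_mult intro: mult_mono)
  have "norm ?g \<le> L * exp (L * \<bar>\<beta> * h\<bar>) * norm ?w * \<bar>\<beta> * h\<bar>"
    by (rule norm_PhiB_diff)
  also have "\<dots> \<le> L * exp (L * (b * T)) * split_norm R x * (b * h)"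
  proof (intro mult_mono)
    show "norm ?w \<le> split_norm R x"
      by (simp add: U_group(3) split_norm_def)
    show "exp (L * \<bar>\<beta> * h\<bar>) \<le> exp (L * (b * T))"
      using \<beta>h L by (simp add: mult_left_mono)
  qed (use L \<beta>h in \<open>auto simp: split_norm_def\<close>)
  finally have "(2 * M + 1) * norm ?g \<le> (2 * M + 1) * (L * exp (L * (b * T)) * split_norm R x * (b * h))"
    using M by (intro mult_left_mono) auto
  then have "split_norm R ?g \<le> (2 * M + 1) * (L * exp (L * (b * T)) * split_norm R x * (b * h))"
    using split_norm_le[OF R, of ?g] by linarith
  moreover have "split_norm R (PhiB J B (\<beta> * h) ?w) \<le> split_norm R ?w + split_norm R ?g"
    using split_norm_add[OF R, of ?w ?g] by simp
  ultimately show ?thesis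
    using split_norm_U_P[OF R, of t x] by (simp add: algebra_simps)
qed

abbreviation substeps :: "(nat \<Rightarrow> real) \<Rightarrow> (nat \<Rightarrow> real) \<Rightarrow> real \<Rightarrow> real \<Rightarrow> nat \<Rightarrow> 'a \<Rightarrow> 'a"
  where "substeps a b h R j \<equiv> compose_steps (\<lambda>j v. PhiB J B (b j * h) (U (a j * h) (P R v))) j"

text \<open>Factors \<open>1 + g * h\<close> accumulate to an exponential in elapsed time, and the
  equivalence constant \<open>2 * M + 1\<close> is paid once for the whole iteration. The substep
  bound serves the consistency proof, the iterate bound the convergence proof.\<close>

lemma stability:
  assumes "0 \<le> T"
  shows "\<exists>G\<ge>0. \<forall>h R j k x. 0 < h \<and> real k * h \<le> T \<and> h \<le> T \<and> 0 < R \<and> j \<le> s \<longrightarrow>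
    split_norm R (substeps a b h R j x) \<le> exp (G * h) * split_norm R x \<and>
    norm ((split_step J U B (P R) s a b h ^^ k) x) \<le> exp (G * T) * (2 * M + 1) * norm x"
proof -
  define \<beta> where "\<beta> = (\<Sum>j\<in>{1..s}. \<bar>b j\<bar>)"
  have \<beta>: "\<bar>b j\<bar> \<le> \<beta>" if "1 \<le> j" "j \<le> s" for j
    unfolding \<beta>_def using that by (intro member_le_sum) auto
  have "0 \<le> \<beta>"
    by (simp add: \<beta>_def sum_nonneg)
  define g where "g = (2 * M + 1) * L * exp (L * (\<beta> * T)) * \<beta>"
  have "0 \<le> g"
    using M L \<open>0 \<le> \<beta>\<close> by (simp add: g_def)
  define G where "G = real s * g"
  have "0 \<le> G"
    using \<open>0 \<le> g\<close> by (simp add: G_def)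
  have nonneg: "0 \<le> split_norm R x" for R x
    by (simp add: split_norm_def)
  have step: "split_norm R (substeps a b h R j x) \<le> exp (real j * (g * h)) * split_norm R x"
    if h: "0 < h" "h \<le> T" and R: "0 < R" and "j \<le> s" for h R j x
    using \<open>j \<le> s\<close>
  proof (induction j)
    case 0
    then show ?case by simp
  next
    case (Suc j)
    have "split_norm R (substeps a b h R (Suc j) x) \<le> (1 + g * h) * split_norm R (substeps a b h R j x)"
      using split_norm_substep[OF R less_imp_le[OF h(1)] h(2) \<beta>[of "Suc j"]] Suc.prems
      by (simp add: g_def)
    also have "\<dots> \<le> exp (g * h) * split_norm R (substeps a b h R j x)"
      by (intro mult_right_mono exp_ge_add_one_self nonneg)
    also have "\<dots> \<le> exp (g * h) * (exp (real j * (g * h)) * split_norm R x)"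
      using Suc by (intro mult_left_mono) auto
    also have "\<dots> = exp (real (Suc j) * (g * h)) * split_norm R x"
      by (simp add: exp_add distrib_right)
    finally show ?case .
  qed
  have step': "split_norm R (substeps a b h R j x) \<le> exp (G * h) * split_norm R x"
    if h: "0 < h" "h \<le> T" and R: "0 < R" and "j \<le> s" for h R j x
  proof -
    have "real j * (g * h) \<le> G * h"
      unfolding G_def mult.assoc using \<open>0 \<le> g\<close> that by (intro mult_right_mono) auto
    then show ?thesis
      using step[OF that, of x] nonneg[of R x] by (meson exp_le_cancel_iff mult_right_mono order_trans)
  qed
  have iter: "split_norm R ((split_step J U B (P R) s a b h ^^ k) x) \<le> exp (real k * (G * h)) * split_norm R x"
    if h: "0 < h" "h \<le> T" and R: "0 < R" for h R k x
  proof (induction k)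
    case 0
    then show ?case by simp
  next
    case (Suc k)
    have "split_norm R ((split_step J U B (P R) s a b h ^^ Suc k) x)
        \<le> exp (G * h) * split_norm R ((split_step J U B (P R) s a b h ^^ k) x)"
      using step'[OF that order_refl] by (simp add: split_step_def)
    also have "\<dots> \<le> exp (G * h) * (exp (real k * (G * h)) * split_norm R x)"
      using Suc by (intro mult_left_mono) auto
    also have "\<dots> = exp (real (Suc k) * (G * h)) * split_norm R x"
      by (simp add: exp_add distrib_right)
    finally show ?case .
  qed
  have "norm ((split_step J U B (P R) s a b h ^^ k) x) \<le> exp (G * T) * (2 * M + 1) * norm x"
    if h: "0 < h" "h \<le> T" and k: "real k * h \<le> T" and R: "0 < R" for h R k x
  proof -
    have "G * (real k * h) \<le> G * T"
      using k \<open>0 \<le> G\<close> by (rule mult_left_mono)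
    then have "exp (real k * (G * h)) \<le> exp (G * T)"
      by (simp add: mult_ac)
    then have "exp (real k * (G * h)) * split_norm R x \<le> exp (G * T) * ((2 * M + 1) * norm x)"
      using split_norm_le[OF R] nonneg by (intro mult_mono) auto
    then show ?thesis
      using iter[OF h R, of k x] norm_le_split_norm[of "(split_step J U B (P R) s a b h ^^ k) x" R]
      by (simp add: mult.assoc)
  qed
  then show ?thesis
    using \<open>0 \<le> G\<close> step' by (intro exI[of _ G]) blast
qed

text \<open>In the interaction picture the error has derivative of weak size
  \<open>B (u t) - U (t + h - \<tau>) (B (u \<tau>))\<close>. This is O(h): \<open>u\<close> is
  weakly Lipschitz in time, and the group moves strongly bounded vectors weakly by O(h). Integration
  over length \<open>h\<close> gives the second factor.\<close>

lemma flow_consistency: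
  assumes "0 \<le> K"
    and u: "mild_sol J U B u0 T' u" and "T < T'"
    and u_le: "\<And>t. t \<in> {0..T} \<Longrightarrow> norm (u t) \<le> K"
    and u_lip: "\<And>t t'. t \<in> {0..T} \<Longrightarrow> t' \<in> {0..T} \<Longrightarrow> q (u t - u t') \<le> \<Lambda> * \<bar>t - t'\<bar>"
  shows "\<exists>C\<ge>0. \<forall>t h. 0 \<le> t \<and> 0 < h \<and> t + h \<le> T \<longrightarrow>
    q (u (t + h) - (U h (u t) - h *\<^sub>R J (B (u t)))) \<le> C * h\<^sup>2"
proof -
  obtain N where N: "0 \<le> N"
    "\<And>v w. norm v \<le> K \<Longrightarrow> norm w \<le> K \<Longrightarrow> q (B v - B w) \<le> N * q (v - w)"
    using \<iota>_B_lip[of K] by blast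
  \<comment> \<open>\<open>\<Lambda>\<close> carries no sign, so its absolute value enters the
    constant.\<close>
  have lip_const: "N * (\<Lambda> * \<bar>r\<bar>) \<le> N * \<bar>\<Lambda>\<bar> * \<bar>r\<bar>" for r
    using N(1) by (simp add: mult.assoc mult_left_mono mult_right_mono)
  define C where "C = N * \<bar>\<Lambda>\<bar> + C0 * (L * K)"
  have "0 \<le> C"
    using N(1) C0 L \<open>0 \<le> K\<close> by (simp add: C_def)
  moreover have "q (u (t + h) - (U h (u t) - h *\<^sub>R J (B (u t)))) \<le> C * h\<^sup>2"
    if t: "0 \<le> t" "0 < h" "t + h \<le> T" for t h
  proof -
    let ?v = "\<lambda>\<tau>. U (- \<tau>) (u \<tau>)"
    \<comment> \<open>The linear term is chosen so that \<open>U (t + h)\<close> maps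
      \<open>?f (t + h) - ?f t\<close> exactly to the local error.\<close>
    let ?f = "\<lambda>\<tau>. ?v \<tau> + \<tau> *\<^sub>R U (- (t + h)) (J (B (u t)))"
    let ?f' = "\<lambda>\<tau>. - J (U (- \<tau>) (B (u \<tau>))) + U (- (t + h)) (J (B (u t)))"
    have seg: "closed_segment t (t + h) = {t..t + h}"
      using t by (simp add: closed_segment_eq_real_ivl)
    have bl: "bounded_linear \<iota>"
      by (rule bounded_linear_intro[where K = C1])
        (use \<iota>_le in \<open>auto simp: linear_add[OF \<iota>] linear_scale[OF \<iota>] mult.commute\<close>)
    have "norm (\<iota> (?f (t + h)) - \<iota> (?f t)) \<le> (C * h) * \<bar>t + h - t\<bar>"
    proof (rule norm_diff_le_derivative_bound, unfold seg)
      fix \<tau> assume \<tau>: "\<tau> \<in> {t..t + h}"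
      then have mem: "\<tau> \<in> {0..T}" "t \<in> {0..T}"
        using t by auto
      have "(?v has_vector_derivative - J (U (- \<tau>) (B (u \<tau>)))) (at \<tau> within {t..t + h})"
        using mild_sol_interaction[OF u \<open>T < T'\<close> mem(1)]
        by (rule has_vector_derivative_within_subset) (use t in auto)
      then have "(?f has_vector_derivative ?f' \<tau>) (at \<tau> within {t..t + h})"
        by (auto intro!: derivative_eq_intros)
      then show "((\<lambda>\<tau>. \<iota> (?f \<tau>)) has_vector_derivative \<iota> (?f' \<tau>)) (at \<tau> within {t..t + h})"
        by (rule bounded_linear.has_vector_derivative[OF bl])
      let ?r = "t + h - \<tau>"
      have "?f' \<tau> = J (U (- (t + h)) (B (u t) - U ?r (B (u \<tau>))))"
        by (simp add: U_simps J_simps U_group(2) flip: U_group(5))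
      then have "q (?f' \<tau>) = q (B (u t) - U ?r (B (u \<tau>)))"
        by (simp only: \<iota>_J \<iota>_U)
      also have "\<dots> \<le> q (B (u t) - B (u \<tau>)) + q (U ?r (B (u \<tau>)) - B (u \<tau>))"
        using q_diff[of "B (u t) - B (u \<tau>)" "U ?r (B (u \<tau>)) - B (u \<tau>)"] by simp
      also have "q (B (u t) - B (u \<tau>)) \<le> N * q (u t - u \<tau>)"
        using mem by (intro N(2) u_le)
      also have "N * q (u t - u \<tau>) \<le> N * (\<Lambda> * \<bar>t - \<tau>\<bar>)"
        using mem N(1) by (intro mult_left_mono u_lip)
      also have "\<dots> \<le> N * \<bar>\<Lambda>\<bar> * \<bar>t - \<tau>\<bar>"
        by (rule lip_const)
      also have "\<dots> \<le> N * \<bar>\<Lambda>\<bar> * h"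
        using \<tau> N(1) by (intro mult_left_mono) auto
      also have "q (U ?r (B (u \<tau>)) - B (u \<tau>)) \<le> C0 * norm (B (u \<tau>)) * \<bar>?r\<bar>"
        by (rule \<iota>_U_diff)
      also have "\<dots> \<le> C0 * (L * K) * h"
      proof (intro mult_mono)
        show "norm (B (u \<tau>)) \<le> L * K"
          using norm_B[of "u \<tau>"] mult_left_mono[OF u_le[OF mem(1)] L] by linarith
      qed (use \<tau> C0 L \<open>0 \<le> K\<close> in auto)
      finally show "q (?f' \<tau>) \<le> C * h"
        by (simp add: C_def distrib_right)
    qed
    then have "q (?f (t + h) - ?f t) \<le> C * h\<^sup>2"
      using t by (simp add: linear_diff[OF \<iota>] power2_eq_square mult.assoc)
    moreover have "U (t + h) (?f (t + h) - ?f t) = u (t + h) - (U h (u t) - h *\<^sub>R J (B (u t)))"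
    proof -
      have "U (t + h) (U (- t) (u t)) = U h (u t)"
        by (simp flip: U_group(5))
      then show ?thesis
        by (simp only: U_simps U_cancel) (simp add: algebra_simps)
    qed
    ultimately show ?thesis
      using \<iota>_U[of "t + h" "?f (t + h) - ?f t"] by simp
  qed
  ultimately show ?thesis by blast
qed

text \<open>Induction over substeps with the partial sums of the coefficients. A further substep
  projects, rotates and adds \<open>- \<beta>' * h\<close> times \<open>J (B w)\<close>; up to
  second order in the weak norm, the projection is invisible, the rotation leaves the earlier
  \<open>J (B v)\<close> fixed, and \<open>B w\<close> may be replaced by
  \<open>B v\<close>.\<close>

lemma substeps_consistency:
  assumes "0 \<le> T" "0 \<le> K" "j \<le> s"
  shows "\<exists>C\<ge>0. \<forall>h R v. 0 < h \<and> h \<le> T \<and> 1 / h\<^sup>2 \<le> R \<and> norm v \<le> K \<longrightarrow>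
    q (substeps a b h R j v - (U ((\<Sum>i=1..j. a i) * h) v - (h * (\<Sum>i=1..j. b i)) *\<^sub>R J (B v))) \<le> C * h\<^sup>2"
  using \<open>j \<le> s\<close>
proof (induction j)
  case 0
  then show ?case
    by (intro exI[of _ 0]) (simp add: U_group(4) q_zero)
next
  case (Suc j)
  have "j \<le> s"
    using Suc.prems by simp
  from Suc.IH[OF this] obtain C where C_nonneg: "0 \<le> C"
    and C: "\<forall>h R v. 0 < h \<and> h \<le> T \<and> 1 / h\<^sup>2 \<le> R \<and> norm v \<le> K \<longrightarrow>
      q (substeps a b h R j v - (U ((\<Sum>i=1..j. a i) * h) v - (h * (\<Sum>i=1..j. b i)) *\<^sub>R J (B v))) \<le> C * h\<^sup>2"
    by (elim exE conjE)
  define \<alpha> \<beta> \<alpha>' \<beta>' where "\<alpha> = (\<Sum>i=1..j. a i)" "\<beta> = (\<Sum>i=1..j. b i)" "\<alpha>' = a (Suc j)" "\<beta>' = b (Suc j)"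
  note defs = this
  from stability[OF \<open>0 \<le> T\<close>, where s = s and a = a and b = b] obtain G where G: "0 \<le> G"
    and G_step: "\<forall>h R j k x. 0 < h \<and> real k * h \<le> T \<and> h \<le> T \<and> 0 < R \<and> j \<le> s \<longrightarrow>
      split_norm R (substeps a b h R j x) \<le> exp (G * h) * split_norm R x \<and>
      norm ((split_step J U B (P R) s a b h ^^ k) x) \<le> exp (G * T) * (2 * M + 1) * norm x"
    by (elim exE conjE)
  \<comment> \<open>The three summands bound \<open>w\<close>, \<open>x\<close> and \<open>v\<close>
    respectively, so one strong ball contains all arguments.\<close>
  define K' where "K' = M * (exp (G * T) * ((2 * M + 1) * K)) + exp (G * T) * ((2 * M + 1) * K) + K"
  have K': "0 \<le> K'" "K \<le> K'"
    using M \<open>0 \<le> K\<close> by (simp_all add: K'_def)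
  obtain N where N: "0 \<le> N"
    "\<And>v w. norm v \<le> K' \<Longrightarrow> norm w \<le> K' \<Longrightarrow> q (B v - B w) \<le> N * q (v - w)"
    using \<iota>_B_lip[of K'] by blast
  \<comment> \<open>\<open>E1\<close> bounds the error after projection and rotation: inherited
    error, cut-off, shift of \<open>J (B v)\<close>. \<open>E2\<close> bounds \<open>w - v\<close>
    to first order, using \<open>h\<^sup>2 \<le> T * h\<close>. \<open>E3\<close> is the Taylor
    remainder of the nonlinear flow.\<close>
  define E1 where "E1 = C + C0 * K' + C0 * (L * K) * \<bar>\<alpha>'\<bar> * \<bar>\<beta>\<bar>"
  define E2 where "E2 = E1 * T + C0 * K * \<bar>\<alpha>' + \<alpha>\<bar> + \<bar>\<beta>\<bar> * (C1 * (L * K))"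
  define E3 where "E3 = C1 * (L\<^sup>2 * exp (L * (\<bar>\<beta>'\<bar> * T)) * K' * \<beta>'\<^sup>2)"
  have nonneg: "0 \<le> E1" "0 \<le> E2" "0 \<le> E3"
    using C0 C1 C_nonneg L K' \<open>0 \<le> K\<close> \<open>0 \<le> T\<close> by (simp_all add: E1_def E2_def E3_def)
  have "q (substeps a b h R (Suc j) v - (U ((\<alpha> + \<alpha>') * h) v - (h * (\<beta> + \<beta>')) *\<^sub>R J (B v)))
      \<le> (E3 + E1 + \<bar>\<beta>'\<bar> * (N * E2)) * h\<^sup>2"
    if h: "0 < h" "h \<le> T" and R: "1 / h\<^sup>2 \<le> R" and v: "norm v \<le> K" for h R v
  proof -
    have "0 < R"
      using h R by (smt (verit) zero_less_divide_1_iff zero_less_power)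
    define x where "x = substeps a b h R j v"
    define w where "w = U (\<alpha>' * h) (P R x)"
    define r where "r = x - (U (\<alpha> * h) v - (h * \<beta>) *\<^sub>R J (B v))"
    define e where "e = w - (U ((\<alpha> + \<alpha>') * h) v - (h * \<beta>) *\<^sub>R J (B v))"
    have norm_x: "norm x \<le> exp (G * T) * ((2 * M + 1) * K)"
    proof -
      have "split_norm R x \<le> exp (G * h) * split_norm R v"
        unfolding x_def using h \<open>0 < R\<close> \<open>0 \<le> T\<close> \<open>j \<le> s\<close>
          G_step[THEN spec[of _ h], THEN spec[of _ R], THEN spec[of _ j], THEN spec[of _ 0], THEN spec[of _ v]] by simp
      then have "norm x \<le> exp (G * h) * split_norm R v"
        using norm_le_split_norm[of x R] by linarith
      also have "\<dots> \<le> exp (G * T) * ((2 * M + 1) * K)"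
      proof (intro mult_mono)
        show "split_norm R v \<le> (2 * M + 1) * K"
          using split_norm_le[OF \<open>0 < R\<close>, of v] mult_left_mono[OF v, of "2 * M + 1"] M by linarith
      qed (use G h in \<open>auto simp: split_norm_def intro: mult_left_mono\<close>)
      finally show ?thesis .
    qed
    have norm_w: "norm w \<le> K'" and norm_x': "norm x \<le> K'"
    proof -
      have "norm w \<le> M * (exp (G * T) * ((2 * M + 1) * K))"
        using norm_P[OF \<open>0 < R\<close>, of x] mult_left_mono[OF norm_x M] by (simp add: w_def U_group(3))
      then show "norm w \<le> K'"
        using M \<open>0 \<le> K\<close> by (simp add: K'_def add_increasing2)
      show "norm x \<le> K'"
        using norm_x M \<open>0 \<le> K\<close> by (simp add: K'_def add_increasing add_increasing2)
    qed
    have norm_Bv: "norm (B v) \<le> L * K"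
      using norm_B[of v] mult_left_mono[OF v L] by linarith
    have q_r: "q r \<le> C * h\<^sup>2"
      unfolding r_def x_def defs using h R v by (intro C[rule_format]) simp
    have q_tail: "q (x - P R x) \<le> C0 * K' * h\<^sup>2"
    proof -
      have "q (x - P R x) \<le> C0 * norm x * h\<^sup>2"
        by (rule \<iota>_P_diff_le[OF h(1) R])
      also have "\<dots> \<le> C0 * K' * h\<^sup>2"
        using norm_x' C0 by (intro mult_right_mono mult_left_mono) auto
      finally show ?thesis .
    qed
    have q_shift: "q (U (\<alpha>' * h) (J (B v)) - J (B v)) \<le> C0 * (L * K) * \<bar>\<alpha>'\<bar> * h"
    proof -
      have "q (U (\<alpha>' * h) (J (B v)) - J (B v)) \<le> C0 * norm (J (B v)) * \<bar>\<alpha>' * h\<bar>"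
        by (rule \<iota>_U_diff)
      also have "\<dots> \<le> C0 * (L * K) * (\<bar>\<alpha>'\<bar> * h)"
        using norm_Bv h C0 L \<open>0 \<le> K\<close> by (intro mult_mono) (auto simp: norm_J abs_mult)
      finally show ?thesis by (simp add: mult.assoc)
    qed
    have e: "q e \<le> E1 * h\<^sup>2"
    proof -
      have "U ((\<alpha> + \<alpha>') * h) v = U (\<alpha>' * h) (U (\<alpha> * h) v)"
        by (simp add: algebra_simps flip: U_group(5))
      then have "e = U (\<alpha>' * h) r - U (\<alpha>' * h) (x - P R x)
          - (h * \<beta>) *\<^sub>R (U (\<alpha>' * h) (J (B v)) - J (B v))"
        by (simp add: e_def r_def w_def U_simps algebra_simps)
      then have "q e \<le> q r + q (x - P R x) + \<bar>h * \<beta>\<bar> * q (U (\<alpha>' * h) (J (B v)) - J (B v))"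
        using q_diff[of "U (\<alpha>' * h) r - U (\<alpha>' * h) (x - P R x)"
            "(h * \<beta>) *\<^sub>R (U (\<alpha>' * h) (J (B v)) - J (B v))"]
          q_diff[of "U (\<alpha>' * h) r" "U (\<alpha>' * h) (x - P R x)"]
        by (simp only: q_scale \<iota>_U)
      also have "\<dots> \<le> C * h\<^sup>2 + C0 * K' * h\<^sup>2 + \<bar>h * \<beta>\<bar> * (C0 * (L * K) * \<bar>\<alpha>'\<bar> * h)"
        by (intro add_mono mult_left_mono q_r q_tail q_shift) simp
      also have "\<dots> = E1 * h\<^sup>2"
        using h by (simp add: E1_def abs_mult power2_eq_square algebra_simps)
      finally show ?thesis .
    qed
    have w: "q (w - v) \<le> E2 * h"
    proof -
      have "w - v = e + (U ((\<alpha>' + \<alpha>) * h) v - v) - (h * \<beta>) *\<^sub>R J (B v)"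
        by (simp add: e_def add.commute)
      then have "q (w - v) \<le> q e + q (U ((\<alpha>' + \<alpha>) * h) v - v) + \<bar>h * \<beta>\<bar> * q (B v)"
        using q_diff[of "e + (U ((\<alpha>' + \<alpha>) * h) v - v)" "(h * \<beta>) *\<^sub>R J (B v)"]
          q_add[of e "U ((\<alpha>' + \<alpha>) * h) v - v"] by (simp only: q_scale \<iota>_J)
      also have "\<dots> \<le> E1 * T * h + C0 * K * \<bar>\<alpha>' + \<alpha>\<bar> * h + \<bar>\<beta>\<bar> * (C1 * (L * K)) * h"
      proof (intro add_mono)
        have "E1 * h\<^sup>2 \<le> E1 * (T * h)"
          using h nonneg by (intro mult_left_mono) (auto simp: power2_eq_square)
        then show "q e \<le> E1 * T * h"
          using e by (simp add: mult.assoc)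
        have "q (U ((\<alpha>' + \<alpha>) * h) v - v) \<le> C0 * norm v * \<bar>(\<alpha>' + \<alpha>) * h\<bar>"
          by (rule \<iota>_U_diff)
        also have "\<dots> \<le> C0 * K * \<bar>(\<alpha>' + \<alpha>) * h\<bar>"
          using v C0 by (intro mult_right_mono mult_left_mono) auto
        finally show "q (U ((\<alpha>' + \<alpha>) * h) v - v) \<le> C0 * K * \<bar>\<alpha>' + \<alpha>\<bar> * h"
          using h by (simp add: abs_mult mult.assoc)
        have "q (B v) \<le> C1 * (L * K)"
          using \<iota>_le[of "B v"] mult_left_mono[OF norm_Bv C1] by linarith
        then have "\<bar>h * \<beta>\<bar> * q (B v) \<le> \<bar>h * \<beta>\<bar> * (C1 * (L * K))"
          by (intro mult_left_mono) auto
        then show "\<bar>h * \<beta>\<bar> * q (B v) \<le> \<bar>\<beta>\<bar> * (C1 * (L * K)) * h"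
          using h by (simp add: abs_mult mult_ac)
      qed
      also have "\<dots> = E2 * h"
        by (simp add: E2_def distrib_right)
      finally show ?thesis .
    qed
    define y where "y = PhiB J B (\<beta>' * h) w"
    have y: "q (y - w + (\<beta>' * h) *\<^sub>R J (B w)) \<le> E3 * h\<^sup>2"
    proof -
      have "norm (y - w + (\<beta>' * h) *\<^sub>R J (B w)) \<le> L\<^sup>2 * exp (L * \<bar>\<beta>' * h\<bar>) * norm w * (\<beta>' * h)\<^sup>2"
        unfolding y_def by (rule norm_PhiB_taylor)
      also have "\<dots> \<le> L\<^sup>2 * exp (L * (\<bar>\<beta>'\<bar> * T)) * K' * (\<beta>' * h)\<^sup>2"
        using norm_w h L K'(1) by (intro mult_mono) (auto simp: abs_mult intro!: mult_left_mono)
      finally have "C1 * norm (y - w + (\<beta>' * h) *\<^sub>R J (B w))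
          \<le> C1 * (L\<^sup>2 * exp (L * (\<bar>\<beta>'\<bar> * T)) * K' * (\<beta>' * h)\<^sup>2)"
        by (rule mult_left_mono[OF _ C1])
      also have "\<dots> = E3 * h\<^sup>2"
        by (simp add: E3_def power_mult_distrib mult.assoc)
      finally show ?thesis
        using \<iota>_le[of "y - w + (\<beta>' * h) *\<^sub>R J (B w)"] by linarith
    qed
    have B: "q (B w - B v) \<le> N * (E2 * h)"
      using N(2)[of w v] norm_w v K' mult_left_mono[OF w N(1)] by linarith
    have "substeps a b h R (Suc j) v = y"
      by (simp add: y_def w_def x_def defs)
    \<comment> \<open>Three sources of error: the Taylor remainder at \<open>w\<close>, the
      accumulated \<open>e\<close>, and the change of base point from \<open>w\<close> to
      \<open>v\<close> in \<open>B\<close>.\<close>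
    moreover have "y - (U ((\<alpha> + \<alpha>') * h) v - (h * (\<beta> + \<beta>')) *\<^sub>R J (B v))
        = (y - w + (\<beta>' * h) *\<^sub>R J (B w)) + e - (\<beta>' * h) *\<^sub>R J (B w - B v)"
      by (simp add: e_def J_simps algebra_simps)
    ultimately have "q (substeps a b h R (Suc j) v - (U ((\<alpha> + \<alpha>') * h) v - (h * (\<beta> + \<beta>')) *\<^sub>R J (B v)))
        \<le> q (y - w + (\<beta>' * h) *\<^sub>R J (B w)) + q e + \<bar>\<beta>' * h\<bar> * q (B w - B v)"
      using q_diff[of "(y - w + (\<beta>' * h) *\<^sub>R J (B w)) + e" "(\<beta>' * h) *\<^sub>R J (B w - B v)"]
        q_add[of "y - w + (\<beta>' * h) *\<^sub>R J (B w)" e] by (simp only: q_scale \<iota>_J)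
    also have "\<dots> \<le> E3 * h\<^sup>2 + E1 * h\<^sup>2 + \<bar>\<beta>' * h\<bar> * (N * (E2 * h))"
      by (intro add_mono mult_left_mono y e B) simp
    also have "\<dots> = (E3 + E1 + \<bar>\<beta>'\<bar> * (N * E2)) * h\<^sup>2"
      using h by (simp add: abs_mult power2_eq_square algebra_simps)
    finally show ?thesis .
  qed
  moreover have "0 \<le> E3 + E1 + \<bar>\<beta>'\<bar> * (N * E2)"
    using nonneg N(1) by simp
  ultimately show ?case
    unfolding defs by (intro exI[of _ "E3 + E1 + \<bar>\<beta>'\<bar> * (N * E2)"]) (simp add: defs)
qed

end

section \<open>Convergence\<close>

lemma discrete_gronwall:
  fixes e :: "nat \<Rightarrow> real"
  assumes "e 0 = 0" and "0 \<le> \<kappa>" "0 \<le> c"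
    and step: "\<And>k. k < n \<Longrightarrow> e (Suc k) \<le> (1 + \<kappa>) * e k + c" and "k \<le> n"
  shows "e k \<le> exp (\<kappa> * real k) * (real k * c)"
  using \<open>k \<le> n\<close>
proof (induction k)
  case 0
  then show ?case using assms(1) by simp
next
  case (Suc k)
  have "e (Suc k) \<le> (1 + \<kappa>) * e k + c"
    using Suc.prems by (intro step) simp
  also have "\<dots> \<le> exp \<kappa> * (exp (\<kappa> * real k) * (real k * c)) + exp (\<kappa> * real (Suc k)) * c"
  proof (rule add_mono)
    have "(1 + \<kappa>) * e k \<le> (1 + \<kappa>) * (exp (\<kappa> * real k) * (real k * c))"
      using Suc \<open>0 \<le> \<kappa>\<close> by (intro mult_left_mono) auto
    also have "\<dots> \<le> exp \<kappa> * (exp (\<kappa> * real k) * (real k * c))"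
      using \<open>0 \<le> c\<close> by (intro mult_right_mono exp_ge_add_one_self) auto
    finally show "(1 + \<kappa>) * e k \<le> exp \<kappa> * (exp (\<kappa> * real k) * (real k * c))" .
    show "c \<le> exp (\<kappa> * real (Suc k)) * c"
      using \<open>0 \<le> c\<close> \<open>0 \<le> \<kappa>\<close> mult_right_mono[of 1 "exp (\<kappa> * real (Suc k))" c] by simp
  qed
  also have "\<dots> = exp (\<kappa> * real (Suc k)) * (real (Suc k) * c)"
    by (simp add: algebra_simps exp_add)
  finally show ?case .
qed

text \<open>Condition (D) controls only strongly small increments. The segment from \<open>v\<close>
  to \<open>u\<close> is cut into pieces shorter than \<open>\<delta>\<close>; its nodes stay in the
  ball by convexity, and the weak lengths of the collinear pieces add up exactly.\<close>

lemma lipschitz_on_balls: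
  fixes f :: "'a::real_normed_vector \<Rightarrow> 'b::real_normed_vector" and \<iota> :: "'a \<Rightarrow> 'c::real_normed_vector"
  assumes "linear \<iota>" and "0 < \<delta>" "0 \<le> K"
    and loc: "\<And>u w. norm u \<le> r \<Longrightarrow> norm w < \<delta> \<Longrightarrow> norm (f (u + w) - f u) \<le> K * norm (\<iota> w)"
    and u: "norm u \<le> r" and v: "norm v \<le> r"
  shows "norm (f u - f v) \<le> K * norm (\<iota> (u - v))"
proof -
  obtain m :: nat where m: "norm (u - v) / \<delta> < real m"
    using reals_Archimedean2 by blast
  then have "0 < real m"
    using \<open>0 < \<delta>\<close> by (smt (verit) divide_nonneg_pos norm_ge_zero)
  then have small: "norm ((1 / real m) *\<^sub>R (u - v)) < \<delta>"
    using m \<open>0 < \<delta>\<close> unfolding norm_scaleR by (simp add: field_simps)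
  define z where "z i = v + (real i / real m) *\<^sub>R (u - v)" for i :: nat
  have z: "norm (z i) \<le> r" if "i \<le> m" for i
  proof -
    have "z i = (1 - real i / real m) *\<^sub>R v + (real i / real m) *\<^sub>R u"
      by (simp add: z_def algebra_simps)
    moreover have "z i \<in> cball 0 r" if "z i = (1 - real i / real m) *\<^sub>R v + (real i / real m) *\<^sub>R u"
      unfolding that using u v \<open>i \<le> m\<close> \<open>0 < real m\<close>
      by (intro convexD[OF convex_cball]) auto
    ultimately show ?thesis by simp
  qed
  have "norm (f (z i) - f v) \<le> K * (real i / real m * norm (\<iota> (u - v)))" if "i \<le> m" for i
    using that
  proof (induction i)
    case 0
    then show ?case by (simp add: z_def)
  next
    case (Suc i)
    have "z (Suc i) = z i + (1 / real m) *\<^sub>R (u - v)"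
      by (simp add: z_def add_divide_distrib scaleR_add_left)
    then have "norm (f (z (Suc i)) - f (z i)) \<le> K * norm (\<iota> ((1 / real m) *\<^sub>R (u - v)))"
      using loc[OF z small] Suc.prems by simp
    also have "\<dots> = K * (1 / real m * norm (\<iota> (u - v)))"
      using \<open>0 < real m\<close> by (simp add: linear_scale[OF \<open>linear \<iota>\<close>])
    finally have "norm (f (z (Suc i)) - f v)
        \<le> K * (1 / real m * norm (\<iota> (u - v))) + K * (real i / real m * norm (\<iota> (u - v)))"
      using Suc norm_triangle_ineq[of "f (z (Suc i)) - f (z i)" "f (z i) - f v"] by simp
    then show ?case
      by (simp add: add_divide_distrib algebra_simps)
  qed
  from this[of m] show ?thesis
    using \<open>0 < real m\<close> by (simp add: z_def)
qed

context splitting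
begin

text \<open>Errors are propagated neither by the exact flow nor by the scheme but by their common
  approximation \<open>U h v - h *\<^sub>R J (B v)\<close>, whose weak Lipschitz constant on a
  strong ball is \<open>1 + N * h\<close>.\<close>

theorem splitting_convergence:
  assumes "0 < T" and u: "mild_sol J U B u0 T' u" and "T < T'"
    and u_lip: "\<And>t t'. t \<in> {0..T} \<Longrightarrow> t' \<in> {0..T} \<Longrightarrow> q (u t - u t') \<le> \<Lambda> * \<bar>t - t'\<bar>"
    and a: "(\<Sum>j=1..s. a j) = 1" and b: "(\<Sum>j=1..s. b j) = 1"
  shows "\<exists>C>0. \<forall>n\<ge>1. \<forall>R. 1 / (T / real n)\<^sup>2 \<le> R \<longrightarrow>
    (\<forall>k\<le>n. q (u (real k * (T / real n)) - (split_step J U B (P R) s a b (T / real n) ^^ k) u0)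
      \<le> C * (T / real n))"
proof -
  have "0 \<le> T" using \<open>0 < T\<close> by simp
  have "compact (u ` {0..T})"
    using u \<open>T < T'\<close> by (intro compact_continuous_image compact_Icc)
      (auto simp: mild_sol_def intro: continuous_on_subset)
  then obtain K1 where "\<forall>x\<in>u ` {0..T}. norm x \<le> K1"
    using compact_imp_bounded bounded_iff by metis
  then have K1: "norm (u t) \<le> K1" if "t \<in> {0..T}" for t
    using that by blast
  have "0 \<le> K1"
    using K1[of 0] \<open>0 \<le> T\<close> norm_ge_zero[of "u 0"] by (simp del: norm_ge_zero)
  from stability[OF \<open>0 \<le> T\<close>, where s = s and a = a and b = b] obtain G where G: "0 \<le> G"
    and G_step: "\<forall>h R j k x. 0 < h \<and> real k * h \<le> T \<and> h \<le> T \<and> 0 < R \<and> j \<le> s \<longrightarrow>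
      split_norm R (substeps a b h R j x) \<le> exp (G * h) * split_norm R x \<and>
      norm ((split_step J U B (P R) s a b h ^^ k) x) \<le> exp (G * T) * (2 * M + 1) * norm x"
    by (elim exE conjE)
  \<comment> \<open>One radius for the exact orbit, by compactness, and for all iterates, by
    stability.\<close>
  define K where "K = K1 + exp (G * T) * (2 * M + 1) * norm u0"
  have K: "0 \<le> K" "K1 \<le> K" "exp (G * T) * (2 * M + 1) * norm u0 \<le> K"
    using \<open>0 \<le> K1\<close> M by (auto simp: K_def)
  have u_le: "norm (u t) \<le> K" if "t \<in> {0..T}" for t
    using K1[OF that] K by simp
  from flow_consistency[OF K(1) u \<open>T < T'\<close> u_le u_lip] obtain C2 where "0 \<le> C2"
    and C2: "\<forall>t h. 0 \<le> t \<and> 0 < h \<and> t + h \<le> T \<longrightarrow>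
      q (u (t + h) - (U h (u t) - h *\<^sub>R J (B (u t)))) \<le> C2 * h\<^sup>2"
    by auto
  from substeps_consistency[where j = s and s = s and a = a and b = b, OF \<open>0 \<le> T\<close> K(1) order_refl]
  obtain C3 where "0 \<le> C3"
    and "\<forall>h R v. 0 < h \<and> h \<le> T \<and> 1 / h\<^sup>2 \<le> R \<and> norm v \<le> K \<longrightarrow>
      q (substeps a b h R s v - (U ((\<Sum>i=1..s. a i) * h) v - (h * (\<Sum>i=1..s. b i)) *\<^sub>R J (B v))) \<le> C3 * h\<^sup>2"
    by (elim exE conjE)
  then have C3: "\<forall>h R v. 0 < h \<and> h \<le> T \<and> 1 / h\<^sup>2 \<le> R \<and> norm v \<le> K \<longrightarrow>
      q (split_step J U B (P R) s a b h v - (U h v - h *\<^sub>R J (B v))) \<le> C3 * h\<^sup>2"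
    by (simp only: a b mult_1_left mult_1_right split_step_def)
  obtain N where N: "0 \<le> N"
    "\<And>v w. norm v \<le> K \<Longrightarrow> norm w \<le> K \<Longrightarrow> q (B v - B w) \<le> N * q (v - w)"
    using \<iota>_B_lip[of K] by blast
  \<comment> \<open>Discrete Gronwall with rate \<open>N * h\<close> and local error
    \<open>(C2 + C3) * h\<^sup>2\<close>, using \<open>real k * h \<le> T\<close>; the 1 ensures
    positivity.\<close>
  define C where "C = exp (N * T) * (T * (C2 + C3)) + 1"
  have "0 < C"
    using \<open>0 \<le> T\<close> \<open>0 \<le> C2\<close> \<open>0 \<le> C3\<close> by (simp add: C_def add_nonneg_pos)
  moreover have "q (u (real k * (T / real n)) - (split_step J U B (P R) s a b (T / real n) ^^ k) u0)
      \<le> C * (T / real n)"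
    if n: "1 \<le> n" and R: "1 / (T / real n)\<^sup>2 \<le> R" and k: "k \<le> n" for n R k
  proof -
    define h where "h = T / real n"
    have nh: "real n * h = T"
      using n by (simp add: h_def)
    have "0 < h"
      using n \<open>0 < T\<close> by (simp add: h_def)
    have le_T: "real k * h \<le> T" if "k \<le> n" for k
      using that \<open>0 < h\<close> by (auto simp flip: nh)
    have "h \<le> T"
      using le_T[of 1] n by simp
    have R: "1 / h\<^sup>2 \<le> R"
      using R by (simp add: h_def)
    then have "0 < R"
      using \<open>0 < h\<close> by (smt (verit) zero_less_divide_1_iff zero_less_power)
    define x where "x k = (split_step J U B (P R) s a b h ^^ k) u0" for k
    define e where "e k = q (u (real k * h) - x k)" for k
    have x_le: "norm (x k) \<le> K" if "k \<le> n" for k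
      using G_step[THEN spec[of _ h], THEN spec[of _ R], THEN spec[of _ 0], THEN spec[of _ k], THEN spec[of _ u0]]
        le_T[OF that] \<open>0 < h\<close> \<open>h \<le> T\<close> \<open>0 < R\<close> K(3) by (simp add: x_def)
    have e_step: "e (Suc k) \<le> (1 + N * h) * e k + (C2 + C3) * h\<^sup>2" if "k < n" for k
    proof -
      let ?t = "real k * h"
      have t: "0 \<le> ?t" "?t + h \<le> T" "?t \<in> {0..T}"
        using le_T[of "Suc k"] that \<open>0 < h\<close> by (auto simp: distrib_right)
      let ?e1 = "u (?t + h) - (U h (u ?t) - h *\<^sub>R J (B (u ?t)))"
      let ?e2 = "x (Suc k) - (U h (x k) - h *\<^sub>R J (B (x k)))"
      have "u (real (Suc k) * h) - x (Suc k)
          = U h (u ?t - x k) - h *\<^sub>R J (B (u ?t) - B (x k)) + (?e1 - ?e2)"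
        by (simp add: U_simps J_simps algebra_simps)
      then have "e (Suc k) \<le> e k + \<bar>h\<bar> * q (B (u ?t) - B (x k)) + (q ?e1 + q ?e2)"
        unfolding e_def
        using q_add[of "U h (u ?t - x k) - h *\<^sub>R J (B (u ?t) - B (x k))" "?e1 - ?e2"]
          q_diff[of "U h (u ?t - x k)" "h *\<^sub>R J (B (u ?t) - B (x k))"] q_diff[of ?e1 ?e2]
        by (simp only: q_scale \<iota>_J \<iota>_U)
      also have "\<dots> \<le> e k + \<bar>h\<bar> * (N * e k) + (C2 * h\<^sup>2 + C3 * h\<^sup>2)"
      proof (intro add_mono mult_left_mono order_refl)
        show "q (B (u ?t) - B (x k)) \<le> N * e k"
          unfolding e_def using that t by (intro N(2) u_le x_le) auto
        show "q ?e1 \<le> C2 * h\<^sup>2"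
          using C2 t \<open>0 < h\<close> by blast
        have "x (Suc k) = split_step J U B (P R) s a b h (x k)"
          by (simp add: x_def)
        then show "q ?e2 \<le> C3 * h\<^sup>2"
          using C3 \<open>0 < h\<close> \<open>h \<le> T\<close> R x_le[of k] that by simp
      qed simp
      finally show ?thesis
        using \<open>0 < h\<close> by (simp add: algebra_simps)
    qed
    have "e 0 = 0"
      using mild_sol_0[OF u] \<open>0 \<le> T\<close> \<open>T < T'\<close> by (simp add: e_def x_def q_zero)
    moreover have "0 \<le> N * h" "0 \<le> (C2 + C3) * h\<^sup>2"
      using N(1) \<open>0 < h\<close> \<open>0 \<le> C2\<close> \<open>0 \<le> C3\<close> by simp_all
    ultimately have "e k \<le> exp (N * h * real k) * (real k * ((C2 + C3) * h\<^sup>2))"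
      using e_step k by (rule discrete_gronwall)
    also have "\<dots> = exp (N * (real k * h)) * (real k * h * (C2 + C3)) * h"
      by (simp add: power2_eq_square mult_ac)
    also have "\<dots> \<le> exp (N * T) * (T * (C2 + C3)) * h"
      using le_T[OF k] N(1) \<open>0 < h\<close> \<open>0 \<le> C2\<close> \<open>0 \<le> C3\<close> \<open>0 \<le> T\<close>
      by (intro mult_right_mono mult_mono) (auto intro: mult_left_mono)
    also have "\<dots> \<le> C * h"
      using \<open>0 < h\<close> by (simp add: C_def distrib_right)
    finally show ?thesis
      by (simp add: e_def x_def h_def)
  qed
  ultimately show ?thesis by blast
qed

end

theorem mainTheorem15:
  fixes J0 :: "'h::{real_inner,complete_space} \<Rightarrow> 'h"
    and J1 :: "'k::{real_inner,complete_space} \<Rightarrow> 'k"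
    and \<iota> :: "'k \<Rightarrow> 'h"
    and D0 :: "'h set" and A0 :: "'h \<Rightarrow> 'h" and U0 :: "real \<Rightarrow> 'h \<Rightarrow> 'h"
    and D1 :: "'k set" and A1 :: "'k \<Rightarrow> 'k" and U1 :: "real \<Rightarrow> 'k \<Rightarrow> 'k"
    and E :: "real set \<Rightarrow> 'h \<Rightarrow> 'h"
    and P1 :: "real \<Rightarrow> 'k \<Rightarrow> 'k"
    and B :: "'k \<Rightarrow> 'k" and B' :: "'k \<Rightarrow> 'h \<Rightarrow>\<^sub>L 'h"
    and s :: nat and a b :: "nat \<Rightarrow> real"
    and u0 :: 'k and T :: real
  assumes J0: "cstruct J0" and J1: "cstruct J1"
    and emb: "bounded_linear \<iota>" "inj \<iota>" "\<forall>v. \<iota> (J1 v) = J0 (\<iota> v)"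
    and A1_sa: "selfadjoint_op J1 D1 A1"
    and A0_sa: "selfadjoint_op J0 D0 A0"
    and A0_ext: "range \<iota> \<subseteq> D0" "\<forall>v\<in>D1. \<iota> (A1 v) = A0 (\<iota> v)"
    and U0: "unitary_group_of J0 D0 A0 U0"
    and U1: "unitary_group_of J1 D1 A1 U1"
    and U_agree: "\<forall>t v. \<iota> (U1 t v) = U0 t (\<iota> v)"
    and B_lip: "\<exists>L. \<forall>u w. norm (B u - B w) \<le> L * norm (u - w)"
    and B0: "B 0 = 0"
    and condD: "\<forall>R>0. \<forall>\<epsilon>>0. \<exists>C>0. \<exists>\<delta>>0. \<forall>u w. norm u \<le> R \<and> norm w < \<delta> \<longrightarrow>
                  norm (B' u) \<le> C \<and>
                  norm (\<iota> (B (u + w)) - \<iota> (B u) - blinfun_apply (B' u) (\<iota> w)) \<le> \<epsilon> * norm (\<iota> w)"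
    and W1inf: "\<forall>v0 T'. 0 \<le> T' \<and> ereal T' < Tstar J1 U1 B v0 \<longrightarrow>
                  (\<exists>L. \<forall>t\<in>{0..T'}. \<forall>t'\<in>{0..T'}.
                     norm (\<iota> (Phi J1 U1 B t v0) - \<iota> (Phi J1 U1 B t' v0)) \<le> L * \<bar>t - t'\<bar>)"
    and E_spec: "spectral_measure_of J0 D0 A0 E"
    and P1: "\<forall>R>0. bounded_linear (P1 R) \<and> (\<forall>v. \<iota> (P1 R v) = E {-R..R} (\<iota> v))"
    and P1_bdd: "\<exists>M. \<forall>R>0. onorm (P1 R) \<le> M"
    and a_sum: "(\<Sum>j=1..s. a j) = 1" and b_sum: "(\<Sum>j=1..s. b j) = 1"
    and T_pos: "0 < T" and T_lt: "ereal T < Tstar J1 U1 B u0"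
  shows "\<exists>C>0. \<exists>n0::nat. \<forall>n\<ge>n0. \<forall>R. 1 / (T / real n)\<^sup>2 \<le> R \<longrightarrow>
           (\<forall>k\<le>n. norm (\<iota> (Phi J1 U1 B (real k * (T / real n)) u0)
                     - \<iota> ((split_step J1 U1 B (P1 R) s a b (T / real n) ^^ k) u0))
                   \<le> C * (T / real n))"
proof -
  interpret E: unitary_spectral J0 E D0 A0 U0
    by unfold_locales (use J0 A0_sa E_spec U0 in \<open>auto simp: spectral_measure_of_def\<close>)
  have \<iota>_D: "\<iota> v \<in> D0" for v
    using A0_ext(1) by blast
  have \<iota>: "linear \<iota>"
    using emb(1) by (rule bounded_linear.linear)
  obtain L0 where L0: "\<And>u w. norm (B u - B w) \<le> L0 * norm (u - w)"
    using B_lip by blast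
  obtain M0 where M0: "\<And>R. 0 < R \<Longrightarrow> onorm (P1 R) \<le> M0"
    using P1_bdd by blast
  obtain C1 where C1: "0 \<le> C1" "\<And>v. norm (\<iota> v) \<le> C1 * norm v"
    using bounded_linear.nonneg_bounded[OF emb(1)] by (auto simp: mult.commute)
  have bl_E: "bounded_linear (\<lambda>v. R *\<^sub>R (\<iota> v - E {-R..R} (\<iota> v)))" for R
    by (intro bounded_linear_scaleR_right[THEN bounded_linear_compose] bounded_linear_sub emb(1)
        bounded_linear_compose[OF E.bounded_linear_E emb(1)]) simp
  have bl_U: "bounded_linear (\<lambda>v. (1 / t) *\<^sub>R (U0 t (\<iota> v) - \<iota> v))" for t
    by (intro bounded_linear_scaleR_right[THEN bounded_linear_compose] bounded_linear_sub emb(1)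
        bounded_linear_compose[OF E.U_group(1) emb(1)])
  \<comment> \<open>For each fixed \<open>v\<close> the family is bounded by
    \<open>2 * norm (A0 (\<iota> v))\<close>, since \<open>\<iota> v\<close> lies in
    \<open>D0\<close>; uniform boundedness turns this into a multiple of the strong norm.\<close>
  have "\<exists>C>0. \<forall>R\<in>{0<..}. \<forall>v. norm (R *\<^sub>R (\<iota> v - E {-R..R} (\<iota> v))) \<le> C * norm v"
  proof (rule uniform_boundedness)
    show "\<exists>K. \<forall>R\<in>{0<..}. norm (R *\<^sub>R (\<iota> v - E {-R..R} (\<iota> v))) \<le> K" for v
      using E.spectral_tail[OF \<iota>_D, of _ v] by (intro exI[of _ "2 * norm (A0 (\<iota> v))"]) simp
  qed (rule bl_E)
  then obtain C2 where C2: "0 < C2"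
    "\<And>R v. 0 < R \<Longrightarrow> R * norm (\<iota> v - E {-R..R} (\<iota> v)) \<le> C2 * norm v"
    by auto
  have "\<exists>C>0. \<forall>t\<in>-{0}. \<forall>v. norm ((1 / t) *\<^sub>R (U0 t (\<iota> v) - \<iota> v)) \<le> C * norm v"
  proof (rule uniform_boundedness)
    show "\<exists>K. \<forall>t\<in>-{0}. norm ((1 / t) *\<^sub>R (U0 t (\<iota> v) - \<iota> v)) \<le> K" for v
      using E.norm_U_diff[OF \<iota>_D, of _ v]
      by (intro exI[of _ "norm (A0 (\<iota> v))"]) (simp add: divide_le_eq)
  qed (rule bl_U)
  then obtain C3 where C3: "0 < C3" "\<And>t v. t \<noteq> 0 \<Longrightarrow> norm (U0 t (\<iota> v) - \<iota> v) / \<bar>t\<bar> \<le> C3 * norm v"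
    by auto
  have P1_lin: "bounded_linear (P1 R)" and P1_\<iota>: "\<iota> (P1 R v) = E {-R..R} (\<iota> v)" if "0 < R" for R v
    using P1 that by auto
  \<comment> \<open>Absolute values supply the signs that \<open>L0\<close> and \<open>M0\<close>
    lack; \<open>C2 + C3\<close> serves both the tail and the group estimate.\<close>
  interpret splitting J1 B "\<bar>L0\<bar>" D1 A1 U1 \<iota> P1 "C2 + C3" C1 "\<bar>M0\<bar>"
  proof (intro splitting.intro splitting_axioms.intro mild_flow.intro mild_flow_axioms.intro
      nonlinear_flow.intro)
    show "norm (B u - B w) \<le> \<bar>L0\<bar> * norm (u - w)" for u w
      using L0[of u w] mult_right_mono[OF abs_ge_self[of L0], of "norm (u - w)"] by simp
    show "norm (\<iota> x) \<le> C1 * norm x" for x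
      by (rule C1(2))
    show "norm (\<iota> (U1 t x)) = norm (\<iota> x)" for t x
      by (simp add: U_agree E.U_group(3))
    show "norm (\<iota> (J1 x)) = norm (\<iota> x)" for x
      using J0 by (simp add: emb(3) cstruct_def norm_eq_sqrt_inner)
    show "norm (\<iota> (U1 t x - x)) \<le> (C2 + C3) * norm x * \<bar>t\<bar>" for t x
    proof (cases "t = 0")
      case True
      then show ?thesis
        using unitary_group_ofD(4)[OF U1] by (simp add: linear_0[OF \<iota>])
    next
      case False
      then have "norm (U0 t (\<iota> x) - \<iota> x) \<le> C3 * norm x * \<bar>t\<bar>"
        using C3(2)[OF False, of x] by (simp add: divide_le_eq)
      then show ?thesis
        using C2(1) by (simp add: linear_diff[OF \<iota>] U_agree distrib_right add_increasing)
    qed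
    show "R * norm (\<iota> (x - P1 R x)) \<le> (C2 + C3) * norm x" if "0 < R" for R x
      using C2(2)[OF that, of x] C3(1)
      by (simp add: linear_diff[OF \<iota>] P1_\<iota>[OF that] distrib_right add_increasing2)
    show "linear (P1 R)" if "0 < R" for R
      using P1_lin[OF that] by (rule bounded_linear.linear)
    show "norm (P1 R x) \<le> \<bar>M0\<bar> * norm x" if "0 < R" for R x
      using onorm[OF P1_lin[OF that], of x] mult_right_mono[of "onorm (P1 R)" "\<bar>M0\<bar>" "norm x"] M0[OF that]
      by (meson abs_ge_self norm_ge_zero order_trans)
    \<comment> \<open>These identities hold after applying \<open>\<iota>\<close>, where
      \<open>P1 R\<close> becomes the spectral projection; injectivity pulls them back.\<close>
    show "P1 R (P1 R x) = P1 R x" if "0 < R" for R x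
      by (rule injD[OF emb(2)]) (simp add: P1_\<iota>[OF that] E.E_idem)
    show "P1 R (U1 t x) = U1 t (P1 R x)" if "0 < R" for R t x
      by (rule injD[OF emb(2)]) (simp add: P1_\<iota>[OF that] U_agree E.E_U[OF _ \<iota>_D])
    show "\<exists>K\<ge>0. \<forall>u w. norm u \<le> r \<and> norm w \<le> r \<longrightarrow> norm (\<iota> (B u - B w)) \<le> K * norm (\<iota> (u - w))" for r
    proof -
      define r' where "r' = \<bar>r\<bar> + 1"
      have r': "0 < r'" "r \<le> r'"
        by (auto simp: r'_def)
      \<comment> \<open>With tolerance 1 the increment of \<open>B\<close> is at most
        \<open>C + 1\<close> times the weak norm of \<open>w\<close>: \<open>C\<close> from the
        linear part, 1 from the remainder.\<close>
      from condD[rule_format, OF r'(1) zero_less_one] obtain C \<delta> where C: "0 < C" "0 < \<delta>"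
        and D: "\<forall>u w. norm u \<le> r' \<and> norm w < \<delta> \<longrightarrow> norm (B' u) \<le> C \<and>
          norm (\<iota> (B (u + w)) - \<iota> (B u) - blinfun_apply (B' u) (\<iota> w)) \<le> 1 * norm (\<iota> w)"
        by (elim exE conjE)
      have "norm (\<iota> (B (u + w)) - \<iota> (B u)) \<le> (C + 1) * norm (\<iota> w)"
        if "norm u \<le> r" "norm w < \<delta>" for u w
      proof -
        have D': "norm (B' u) \<le> C"
          "norm (\<iota> (B (u + w)) - \<iota> (B u) - blinfun_apply (B' u) (\<iota> w)) \<le> norm (\<iota> w)"
          using D[rule_format, of u w] that r'(2) by auto
        have "norm (blinfun_apply (B' u) (\<iota> w)) \<le> C * norm (\<iota> w)"
          using norm_blinfun[of "B' u" "\<iota> w"] mult_right_mono[OF D'(1), of "norm (\<iota> w)"] by simp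
        then show ?thesis
          using D'(2) norm_triangle_sub[of "\<iota> (B (u + w)) - \<iota> (B u)" "blinfun_apply (B' u) (\<iota> w)"]
          by (simp add: distrib_right)
      qed
      from lipschitz_on_balls[OF \<iota> C(2) _ this]
      have "norm (\<iota> (B u) - \<iota> (B w)) \<le> (C + 1) * norm (\<iota> (u - w))" if "norm u \<le> r" "norm w \<le> r" for u w
        using C(1) that by simp
      then show ?thesis
        using C(1) by (intro exI[of _ "C + 1"]) (simp add: linear_diff[OF \<iota>])
    qed
  qed (use J1 B0 U1 \<iota> C1 C2 C3 in auto)
  \<comment> \<open>Strict inequality below the supremum yields a mild solution beyond
    \<open>T\<close>, so \<open>T\<close> itself is covered.\<close>
  obtain T' u where T': "T < T'" and u: "mild_sol J1 U1 B u0 T' u"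
    using T_lt unfolding Tstar_def less_SUP_iff by auto
  have Phi_u: "Phi J1 U1 B t u0 = u t" if "t \<in> {0..T}" for t
    using that T' by (intro Phi_eq_mild_sol[OF u]) auto
  obtain \<Lambda> where \<Lambda>: "\<forall>t\<in>{0..T}. \<forall>t'\<in>{0..T}.
      norm (\<iota> (Phi J1 U1 B t u0) - \<iota> (Phi J1 U1 B t' u0)) \<le> \<Lambda> * \<bar>t - t'\<bar>"
    using W1inf T_lt T_pos by (meson less_imp_le)
  have lip: "norm (\<iota> (u t - u t')) \<le> \<Lambda> * \<bar>t - t'\<bar>" if "t \<in> {0..T}" "t' \<in> {0..T}" for t t'
    using \<Lambda>[rule_format, OF that] by (simp only: Phi_u[OF that(1)] Phi_u[OF that(2)] linear_diff[OF \<iota>])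
  have "\<exists>C>0. \<forall>n\<ge>1. \<forall>R. 1 / (T / real n)\<^sup>2 \<le> R \<longrightarrow>
      (\<forall>k\<le>n. norm (\<iota> (u (real k * (T / real n)) - (split_step J1 U1 B (P1 R) s a b (T / real n) ^^ k) u0))
        \<le> C * (T / real n))"
    by (rule splitting_convergence[OF T_pos u T' _ a_sum b_sum]) (rule lip)
  then obtain C where "0 < C" and C: "\<forall>n\<ge>1. \<forall>R. 1 / (T / real n)\<^sup>2 \<le> R \<longrightarrow>
      (\<forall>k\<le>n. norm (\<iota> (u (real k * (T / real n)) - (split_step J1 U1 B (P1 R) s a b (T / real n) ^^ k) u0))
        \<le> C * (T / real n))"
    by (elim exE conjE)
  have "Phi J1 U1 B (real k * (T / real n)) u0 = u (real k * (T / real n))" if "1 \<le> n" "k \<le> n" for k n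
    using that T_pos by (intro Phi_u) (auto simp: divide_le_eq mult.commute)
  then show ?thesis
    using \<open>0 < C\<close> C by (intro exI[of _ C] conjI exI[of _ 1]) (simp_all add: linear_diff[OF \<iota>])
qed

end
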